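(* Let $\alpha'=0$, let $\alpha,\beta,\gamma,\gamma'\ge 0$ and $\beta'>0$ be real numbers, and let $X_n$ be the random variables associated with these parameters (see context), with mean $\mu_n=\mathbb{E}X_n$ and variance $\sigma_n^2=\operatorname{var}(X_n)$. (i) If $\alpha,\beta>0$, then $$\frac{X_n-\mu_n}{\sigma_n}\xrightarrow{d}\mathrm{N}(0,1)\quad\text{as } n\to\infty,$$ with $\mu_n\sim-\mathfrak m\, n$ and $\sigma_n^2\sim-\mathfrak v\, n$, where, with $\rho_1=\frac1\alpha\left(1-(1+\beta/\beta')^{-\alpha/\beta}\right)$, $$\mathfrak m=-\frac{\alpha(1+\beta/\beta')^{-1-\alpha/\beta}}{\beta'\left(1-(1+\beta/\beta')^{-\alpha/\beta}\right)},\qquad \mathfrak v=\frac{(1+\beta/\beta')^{-2-\alpha/\beta}}{(\rho_1\beta')^2}\left(\frac{\beta'}{\alpha}\left(1-(1+\beta/\beta')^{-\alpha/\beta}\right)-1\right).$$ (ii) If $\alpha=0$ and $\beta>0$, then $(X_n-\mu_n)/\sigma_n\xrightarrow{d}\mathrm{N}(0,1)$ as $n\to\infty$, with $\mu_n\sim-\mathfrak m\, n$ and $\sigma_n^2\sim-\mathfrak v\, n$, where, with $\rho_1=\frac1\beta\log(1+\beta/\beta')$, $$\mathfrak m=\frac{-\beta}{(\beta'+\beta)\log(1+\beta/\beta')},\qquad \mathfrak v=\frac{\frac{\beta'}{\beta}\log(1+\beta/\beta')-1}{(\rho_1(\beta'+\beta))^2}.$$ (iii) If $\alpha>0$ and $\beta=0$,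 then $(X_n-\mu_n)/\sigma_n\xrightarrow{d}\mathrm{N}(0,1)$ as $n\to\infty$, with $\mu_n\sim-\mathfrak m\, n$ and $\sigma_n^2\sim-\mathfrak v\, n$, where, with $\rho_1=\frac1\alpha\left(1-e^{-\alpha/\beta'}\right)$, $$\mathfrak m=\frac{\alpha e^{-\alpha/\beta'}}{\beta'(e^{-\alpha/\beta'}-1)},\qquad \mathfrak v=\frac{e^{-\alpha/\beta'}}{(\rho_1\beta')^2}\left(\frac{\beta'}{\alpha}\left(1-e^{-\alpha/\beta'}\right)-1\right).$$
   Context: For real parameters $\alpha,\beta,\gamma,\alpha',\beta',\gamma'$, the numbers $\left|{n\atop k}\right|$, $0\le k\le n$, are defined by the recurrence $$\left|{n\atop k}\right|=(\alpha n+\beta k+\gamma)\left|{n-1\atop k}\right|+(\alpha' n+\beta' k+\gamma')\left|{n-1\atop k-1}\right|+I_{n=k=0},$$ with $\left|{n\atop k}\right|=0$ unless $0\le k\le n$; thus $\left|{0\atop 0}\right|=1$. The random variable $X_n$ is the integer-valued random variable with $$\mathbb{P}(X_n=k)=\frac{\left|{n\atop k}\right|}{\sum_{j=0}^n\left|{n\atop j}\right|},\qquad 0\le k\le n.$$ $\xrightarrow{d}$ denotes convergence in distribution, $\mathrm{N}(0,1)$ is the standard normal distribution, and $a_n\sim b_n$ means $a_n/b_n\to1$ as $n\to\infty$. *)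

theory Defs
  imports "HOL-Probability.Probability"
begin

text \<open>
  The triangular array is indexed by natural numbers \<open>n\<close>, \<open>k\<close>; the term with \<open>k - 1 = -1\<close>
  and the values with \<open>k > n\<close> vanish (\<open>gkp_recurrence\<close> and \<open>gkp_eq_0\<close> below).
  The variables \<open>a\<close>, \<open>b\<close>, \<open>c\<close>, \<open>a'\<close>, \<open>b'\<close>, \<open>c'\<close> stand for
  \<open>\<alpha>\<close>, \<open>\<beta>\<close>, \<open>\<gamma>\<close>, \<open>\<alpha>'\<close>, \<open>\<beta>'\<close>, \<open>\<gamma>'\<close>.
\<close>

fun gkp :: "real \<Rightarrow> real \<Rightarrow> real \<Rightarrow> real \<Rightarrow> real \<Rightarrow> real \<Rightarrow> nat \<Rightarrow> nat \<Rightarrow> real" where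
  "gkp a b c a' b' c' 0 k = (if k = 0 then 1 else 0)"
| "gkp a b c a' b' c' (Suc n) k =
     (a * real (Suc n) + b * real k + c) * gkp a b c a' b' c' n k +
     (if k = 0 then 0
      else (a' * real (Suc n) + b' * real k + c') * gkp a b c a' b' c' n (k - 1))"

lemma gkp_eq_0: "n < k \<Longrightarrow> gkp a b c a' b' c' n k = 0"
proof (induction n arbitrary: k)
  case (Suc n)
  then have "gkp a b c a' b' c' n k = 0" "gkp a b c a' b' c' n (k - 1) = 0"
    by (auto intro!: Suc.IH)
  then show ?case by simp
qed simp

text \<open>The recurrence for \<open>0 \<le> k \<le> n\<close>, with the array extended by \<open>0\<close> to all integers.\<close>

lemma gkp_recurrence:
  fixes a b c a' b' c' :: real and n k :: int
  defines "T \<equiv> \<lambda>n k. if 0 \<le> k \<and> k \<le> n then gkp a b c a' b' c' (nat n) (nat k) else 0"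
  assumes "0 \<le> k" "k \<le> n"
  shows "T n k = (a * n + b * k + c) * T (n - 1) k
               + (a' * n + b' * k + c') * T (n - 1) (k - 1)
               + (if n = 0 \<and> k = 0 then 1 else 0)"
proof (cases "n = 0")
  case True
  then show ?thesis using assms by simp
next
  case False
  then obtain m where n: "n = int (Suc m)"
    using assms by (metis dual_order.trans not0_implies_Suc of_nat_0 zero_le_imp_eq_int)
  obtain l where k: "k = int l"
    using assms by (metis zero_le_imp_eq_int)
  have m: "int (Suc m) - 1 = int m" and Suc_i: "int (Suc i) - 1 = int i" for i
    by simp_all
  show ?thesis
  proof (cases l)
    case 0
    then show ?thesis unfolding T_def n k m by (simp del: of_nat_Suc)
  next
    case (Suc i)
    have "int (Suc i) \<le> int (Suc m)" using assms(3) unfolding n k Suc .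
    then show ?thesis
      unfolding T_def n k m Suc Suc_i by (auto simp: gkp_eq_0 simp del: of_nat_Suc)
  qed
qed

definition gkp_random_variable ::
  "real \<Rightarrow> real \<Rightarrow> real \<Rightarrow> real \<Rightarrow> real \<Rightarrow> real \<Rightarrow> nat \<Rightarrow> 'w measure \<Rightarrow> ('w \<Rightarrow> int) \<Rightarrow> bool" where
  "gkp_random_variable a b c a' b' c' n M X \<longleftrightarrow>
     prob_space M \<and> X \<in> M \<rightarrow>\<^sub>M count_space UNIV \<and>
     (\<forall>k\<le>n. measure M {\<omega> \<in> space M. X \<omega> = int k} =
        gkp a b c a' b' c' n k / (\<Sum>j\<le>n. gkp a b c a' b' c' n j))"

end

theory Submission
  imports Defs "HOL-Complex_Analysis.Complex_Analysis"
begin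

text \<open>
  Let \<open>L\<close> and \<open>E\<close> solve \<open>(1 - \<alpha> w) L' = 1 + \<beta> L\<close>, \<open>L 0 = 0\<close>, and \<open>(1 - \<alpha> w) E' = (\<alpha> + \<gamma>) E\<close>,
  \<open>E 0 = 1\<close>. For \<open>\<alpha>' = 0\<close> the row polynomials \<open>P\<^sub>n\<close> have the exponential generating function
  \<open>E(w) (1 - \<beta>' x L(w)) powr (- r)\<close> with \<open>r = 1 + \<gamma>' / \<beta>'\<close>. Parametrise \<open>x = 1 / (\<beta>' L(u))\<close>. For
  \<open>u\<close> near the positive root \<open>\<rho>\<close> of \<open>L(\<rho>) = 1 / \<beta>'\<close>, the only singularity in a disc of radius
  larger than \<open>\<rho>\<close> is \<open>w = u\<close>, because \<open>L\<close> has nonnegative coefficients and its linear coefficient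
  is positive; it is a factor \<open>(1 - w / u) powr (- r)\<close>. Hence \<open>P\<^sub>n(x) u ^ n / n!\<close>, divided by the
  binomial coefficient \<open>c\<^sub>n\<close> of this factor, converges uniformly in \<open>u\<close>. So the moment generating
  function of \<open>X\<^sub>n\<close> is \<open>exp (n K(s))\<close> times a uniformly convergent factor, where
  \<open>exp (- K(s)) = u / \<rho>\<close> and \<open>exp s = x\<close>. By Cauchy's estimates mean and variance are \<open>n K'(0)\<close>
  and \<open>n K''(0)\<close> up to bounded errors, Levy's theorem gives the normal limit, and the equation for
  \<open>L\<close> turns into \<open>K'(s) = (1 / u - \<alpha>) / (\<beta>' exp s + \<beta>)\<close>.
\<close>

section \<open>The generating function\<close>

definition lin_coeff :: "real \<Rightarrow> real \<Rightarrow> nat \<Rightarrow> real" where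
  "lin_coeff a d n = (\<Prod>j<n. a * real j + d) / fact n"

lemma lin_coeff_0 [simp]: "lin_coeff a d 0 = 1"
  by (simp add: lin_coeff_def)

lemma lin_coeff_Suc: "lin_coeff a d (Suc n) = (a * real n + d) / real (Suc n) * lin_coeff a d n"
  by (simp add: lin_coeff_def)

lemma lin_coeff_nonneg: "a \<ge> 0 \<Longrightarrow> d \<ge> 0 \<Longrightarrow> lin_coeff a d n \<ge> 0"
  by (auto simp: lin_coeff_def intro!: prod_nonneg divide_nonneg_nonneg)

text \<open>Ratio test: consecutive terms have ratio tending to \<open>a * x\<close>, and
  \<open>q\<close> is the midpoint between \<open>a * x\<close> and 1. The hypothesis without
  division covers \<open>a = 0\<close>, where every \<open>x\<close> is allowed.\<close>

lemma summable_lin_coeff: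
  assumes "a \<ge> 0" "d \<ge> 0" "x \<ge> 0" "a * x < 1"
  shows "summable (\<lambda>n. lin_coeff a d n * x ^ n)"
proof -
  define q where "q = (a * x + 1) / 2"
  have "0 \<le> a * x"
    using assms by simp
  then have q: "a * x < q" "q < 1" "0 < q"
    using assms(4) by (simp_all add: q_def field_simps add_pos_nonneg)
  have "(\<lambda>n. (a * real n + d) / real (Suc n) * x) \<longlonglongrightarrow> a * x"
    by real_asymp
  then have "eventually (\<lambda>n. (a * real n + d) / real (Suc n) * x < q) sequentially"
    using q by (auto dest: order_tendstoD)
  then obtain N where N: "\<And>n. n \<ge> N \<Longrightarrow> (a * real n + d) / real (Suc n) * x < q"
    by (auto simp: eventually_sequentially)
  show ?thesis
  proof (rule summable_ratio_test[of q N])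
    fix n assume "n \<ge> N"
    have "norm (lin_coeff a d (Suc n) * x ^ Suc n)
        = (a * real n + d) / real (Suc n) * x * (lin_coeff a d n * x ^ n)"
      using assms lin_coeff_nonneg[of a d] by (simp add: lin_coeff_Suc abs_mult)
    also have "\<dots> \<le> q * (lin_coeff a d n * x ^ n)"
      using N[OF \<open>n \<ge> N\<close>] assms lin_coeff_nonneg[of a d n]
      by (intro mult_right_mono mult_nonneg_nonneg) auto
    also have "\<dots> = q * norm (lin_coeff a d n * x ^ n)"
      using assms lin_coeff_nonneg[of a d] by simp
    finally show "norm (lin_coeff a d (Suc n) * x ^ Suc n) \<le> q * norm (lin_coeff a d n * x ^ n)" .
  qed (use q in auto)
qed

text \<open>
  \<open>lin_fps a d\<close> is the expansion of \<open>(1 - a z) powr (- d / a)\<close>, or of \<open>exp (d z)\<close> if \<open>a = 0\<close>.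
  \<open>L_fps a b\<close> is the expansion of \<open>((1 - a z) powr (- b / a) - 1) / b\<close>, whose limiting cases are
  \<open>(exp (b z) - 1) / b\<close> for \<open>a = 0\<close> and \<open>- ln (1 - a z) / a\<close> for \<open>b = 0\<close>.
\<close>

definition lin_fps :: "real \<Rightarrow> real \<Rightarrow> complex fps" where
  "lin_fps a d = Abs_fps (\<lambda>n. of_real (lin_coeff a d n))"

definition L_coeff :: "real \<Rightarrow> real \<Rightarrow> nat \<Rightarrow> real" where
  "L_coeff a b n = (if n = 0 then 0 else lin_coeff a (a + b) (n - 1) / real n)"

definition L_fps :: "real \<Rightarrow> real \<Rightarrow> complex fps" where
  "L_fps a b = Abs_fps (\<lambda>n. of_real (L_coeff a b n))"

lemma lin_fps_nth [simp]: "fps_nth (lin_fps a d) n = of_real (lin_coeff a d n)"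
  by (simp add: lin_fps_def)

lemma L_fps_nth [simp]: "fps_nth (L_fps a b) n = of_real (L_coeff a b n)"
  by (simp add: L_fps_def)

lemma L_coeff_0 [simp]: "L_coeff a b 0 = 0"
  by (simp add: L_coeff_def)

lemma L_coeff_1 [simp]: "L_coeff a b (Suc 0) = 1"
  by (simp add: L_coeff_def)

lemma fps_deriv_L: "fps_deriv (L_fps a b) = lin_fps a (a + b)"
  by (rule fps_ext) (simp add: L_coeff_def del: of_nat_Suc)

text \<open>Turns an equation for \<open>(1 - A z) F'\<close> into a recurrence for the coefficients
  of \<open>F\<close>, and back.\<close>

lemma fps_nth_ODE_lhs:
  fixes F :: "complex fps"
  shows "fps_nth ((1 - fps_const A * fps_X) * fps_deriv F) n
    = of_nat (Suc n) * fps_nth F (Suc n) - A * of_nat n * fps_nth F n"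
  by (cases n) (simp_all add: ring_distribs mult.assoc del: of_nat_Suc)

lemma lin_fps_ODE:
  "(1 - fps_const (of_real a) * fps_X) * fps_deriv (lin_fps a d) = fps_const (of_real d) * lin_fps a d"
proof (rule fps_ext)
  fix n
  have "real (Suc n) * lin_coeff a d (Suc n) - a * real n * lin_coeff a d n = d * lin_coeff a d n"
    by (simp add: lin_coeff_Suc field_simps del: of_nat_Suc)
  then show "fps_nth ((1 - fps_const (of_real a) * fps_X) * fps_deriv (lin_fps a d)) n
    = fps_nth (fps_const (of_real d) * lin_fps a d) n"
    unfolding fps_nth_ODE_lhs lin_fps_nth fps_mult_left_const_nth
    by (metis of_real_diff of_real_mult of_real_of_nat_eq)
qed

lemma L_fps_ODE:
  "(1 - fps_const (of_real a) * fps_X) * fps_deriv (L_fps a b) = 1 + fps_const (of_real b) * L_fps a b"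
proof (rule fps_ext)
  fix n
  have "real (Suc n) * L_coeff a b (Suc n) - a * real n * L_coeff a b n
      = (if n = 0 then 1 else 0) + b * L_coeff a b n"
    by (cases n) (simp_all add: L_coeff_def lin_coeff_Suc field_simps del: of_nat_Suc, simp add: algebra_simps)
  then have "complex_of_real (real (Suc n) * L_coeff a b (Suc n) - a * real n * L_coeff a b n)
      = of_real ((if n = 0 then 1 else 0) + b * L_coeff a b n)"
    by (rule arg_cong)
  then show "fps_nth ((1 - fps_const (of_real a) * fps_X) * fps_deriv (L_fps a b)) n
    = fps_nth (1 + fps_const (of_real b) * L_fps a b) n"
    unfolding fps_nth_ODE_lhs by (simp add: fps_one_nth del: of_nat_Suc)
qed

section \<open>Column generating functions and row polynomials\<close>

text \<open>The exponential generating function of column \<open>k\<close>: the coefficient of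
  \<open>x ^ k\<close> in \<open>E(w) (1 - b' x L(w)) powr (- r)\<close> with
  \<open>r = 1 + c' / b'\<close>, expanded by the binomial series.\<close>

definition gkp_fps :: "real \<Rightarrow> real \<Rightarrow> real \<Rightarrow> real \<Rightarrow> real \<Rightarrow> nat \<Rightarrow> complex fps" where
  "gkp_fps a b c b' c' k =
     fps_const (of_real (pochhammer (1 + c' / b') k / fact k * b' ^ k)) * (lin_fps a (a + c) * L_fps a b ^ k)"

text \<open>The product rule splits \<open>(E L ^ k)'\<close>: the equation for \<open>E\<close>
  yields \<open>a + c\<close>, that for \<open>L\<close> yields \<open>b * k\<close> together with a
  term in \<open>L ^ (k - 1)\<close>, which the prefactors turn into the previous column.\<close>

lemma gkp_fps_ODE:
  assumes "b' \<noteq> 0"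
  shows "(1 - fps_const (of_real a) * fps_X) * fps_deriv (gkp_fps a b c b' c' k) =
     fps_const (of_real (a + c + b * real k)) * gkp_fps a b c b' c' k +
     (if k = 0 then 0 else fps_const (of_real (b' * real k + c')) * gkp_fps a b c b' c' (k - 1))"
    (is "?A * _ = _")
proof -
  define C where "C k = complex_of_real (pochhammer (1 + c' / b') k / fact k * b' ^ k)" for k
  define E L where "E = lin_fps a (a + c)" and "L = L_fps a b"
  have G: "gkp_fps a b c b' c' k = fps_const (C k) * (E * L ^ k)" for k
    by (simp add: gkp_fps_def C_def E_def L_def)
  have E: "?A * fps_deriv E = fps_const (of_real (a + c)) * E"
    and L: "?A * fps_deriv L = 1 + fps_const (of_real b) * L"
    unfolding E_def L_def by (rule lin_fps_ODE L_fps_ODE)+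
  show ?thesis
  proof (cases k)
    case 0
    then show ?thesis using E by (simp add: G C_def algebra_simps)
  next
    case (Suc m)
    \<comment> \<open>The choice \<open>r = 1 + c' / b'\<close> is what makes consecutive prefactors
      differ by the factor \<open>(b' * k + c') / k\<close>.\<close>
    have C: "of_nat k * C k = of_real (b' * real k + c') * C m"
    proof -
      have "real k * (pochhammer (1 + c' / b') k / fact k * b' ^ k)
          = (b' * real k + c') * (pochhammer (1 + c' / b') m / fact m * b' ^ m)"
      proof -
        have "(1 + c' / b' + real m) * b' = b' * real k + c'"
          using assms by (simp add: Suc field_simps)
        then show ?thesis
          by (simp add: Suc pochhammer_Suc mult_ac del: of_nat_Suc) 
      qed
      then show ?thesis unfolding C_def by (metis of_real_mult of_real_of_nat_eq)
    qed
    have D: "fps_deriv (L ^ k) = fps_const (of_nat k) * fps_deriv L * L ^ m"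
      unfolding fps_deriv_power using Suc by simp
    have Lk: "L ^ k = L * L ^ m"
      by (simp add: Suc)
    have const: "fps_const (of_real (a + c + b * real k) :: complex)
        = fps_const (of_real (a + c)) + fps_const (of_real b) * fps_const (of_nat k)"
      "fps_const (of_nat k * C k) = fps_const (of_nat k) * fps_const (C k)"
      by simp_all
    have "?A * fps_deriv (gkp_fps a b c b' c' k)
       = fps_const (C k) * ((?A * fps_deriv E) * L ^ k + fps_const (of_nat k) * E * (?A * fps_deriv L) * L ^ m)"
      unfolding G fps_deriv_mult D fps_deriv_const by algebra
    also have "\<dots> = fps_const (of_real (a + c + b * real k)) * (fps_const (C k) * (E * L ^ k))
        + fps_const (of_nat k * C k) * (E * L ^ m)"
      unfolding E L const Lk by algebra
    also have "fps_const (of_nat k * C k) = fps_const (of_real (b' * real k + c')) * fps_const (C m)"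
      by (simp add: C)
    finally show ?thesis using Suc by (simp only: G mult.assoc) simp
  qed
qed

text \<open>The term \<open>a * n\<close> from \<open>z F'\<close> joins \<open>a + c\<close> to
  give the \<open>a * Suc n + c\<close> of the recurrence; this is why \<open>E\<close> carries the
  parameter \<open>a + c\<close> rather than \<open>c\<close>.\<close>

lemma gkp_fps_nth_Suc:
  assumes "b' \<noteq> 0"
  shows "of_nat (Suc n) * fps_nth (gkp_fps a b c b' c' k) (Suc n) =
     of_real (a * real (Suc n) + b * real k + c) * fps_nth (gkp_fps a b c b' c' k) n +
     (if k = 0 then 0 else of_real (b' * real k + c') * fps_nth (gkp_fps a b c b' c' (k - 1)) n)"
proof -
  let ?G = "gkp_fps a b c b' c'"
  show ?thesis
    using fps_nth_ODE_lhs[of "of_real a" "?G k" n]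
    unfolding gkp_fps_ODE[OF assms] by (simp add: algebra_simps split: if_splits)
qed

lemma gkp_eq_fps_nth:
  assumes "b' \<noteq> 0"
  shows "of_real (gkp a b c 0 b' c' n k) = fact n * fps_nth (gkp_fps a b c b' c' k) n"
proof (induction n arbitrary: k)
  case 0
  then show ?case by (simp add: gkp_fps_def fps_power_zeroth power_0_left)
next
  case (Suc n)
  have "fact (Suc n) * fps_nth (gkp_fps a b c b' c' k) (Suc n)
      = fact n * (of_nat (Suc n) * fps_nth (gkp_fps a b c b' c' k) (Suc n))"
    by (simp add: algebra_simps)
  also have "\<dots> = of_real (gkp a b c 0 b' c' (Suc n) k)"
    unfolding gkp_fps_nth_Suc[OF assms]
    by (simp add: Suc.IH ring_distribs mult_ac del: of_nat_Suc)
  finally show ?case ..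
qed

lemma gkp_nonneg:
  "\<lbrakk>a \<ge> 0; b \<ge> 0; c \<ge> 0; b' \<ge> 0; c' \<ge> 0\<rbrakk> \<Longrightarrow> gkp a b c 0 b' c' n k \<ge> 0"
  by (induction n arbitrary: k) auto

lemma gkp_diag_pos: "\<lbrakk>b' > 0; c' \<ge> 0\<rbrakk> \<Longrightarrow> gkp a b c 0 b' c' n n > 0"
  by (induction n) (auto simp: gkp_eq_0 intro!: mult_pos_pos add_pos_nonneg)

text \<open>Sums the columns against \<open>x ^ k\<close>. The signs of the generalised binomial
  coefficients at \<open>- r\<close> cancel those of \<open>(- b' x) ^ k\<close>.\<close>

lemma sum_gkp_power:
  fixes x :: complex
  assumes "b' \<noteq> 0"
  shows "(\<Sum>k\<le>n. of_real (gkp a b c 0 b' c' n k) * x ^ k) / fact n =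
     fps_nth (lin_fps a (a + c) *
       (fps_binomial (- of_real (1 + c' / b')) oo (fps_const (- (of_real b' * x)) * L_fps a b))) n"
proof -
  define r where "r = 1 + c' / b'"
  let ?y = "of_real b' * x"
  let ?E = "lin_fps a (a + c)" and ?L = "L_fps a b"
  have gb: "((- of_real r :: complex) gchoose k) * (- ?y) ^ k = of_real (pochhammer r k / fact k * b' ^ k) * x ^ k" for k
  proof -
    have "((- of_real r :: complex) gchoose k) * (- ?y) ^ k
        = ((-1) ^ k * (-1) ^ k) * (pochhammer (of_real r) k / fact k * ?y ^ k)"
      unfolding gbinomial_pochhammer power_minus[of ?y k] minus_minus by (simp only: mult_ac times_divide_eq_left times_divide_eq_right)
    also have "(-1) ^ k * (-1) ^ k = (1 :: complex)"
      by (simp flip: power_mult_distrib)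
    finally show ?thesis
      by (simp add: power_mult_distrib pochhammer_of_real)
  qed
  have "fps_nth (?E * (fps_binomial (- of_real r) oo (fps_const (- ?y) * ?L))) n
     = (\<Sum>i=0..n. fps_nth ?E i * (\<Sum>k=0..n-i. (- of_real r gchoose k) * ((- ?y) ^ k * fps_nth (?L ^ k) (n - i))))"
    unfolding fps_mult_nth[of ?E] fps_compose_nth power_mult_distrib fps_const_power by simp
  \<comment> \<open>\<open>L ^ k\<close> starts at degree \<open>k\<close> or later, so the added
    terms vanish; a range independent of \<open>i\<close> allows the two sums to be swapped.\<close>
  also have "\<dots> = (\<Sum>i=0..n. fps_nth ?E i * (\<Sum>k=0..n. (- of_real r gchoose k) * ((- ?y) ^ k * fps_nth (?L ^ k) (n - i))))"
    by (intro sum.cong arg_cong[of _ _ "(*) _"] sum.mono_neutral_left refl)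
       (auto simp: startsby_zero_power_prefix)
  also have "\<dots> = (\<Sum>k=0..n. of_real (pochhammer r k / fact k * b' ^ k) * x ^ k * fps_nth (?E * ?L ^ k) n)"
    unfolding fps_mult_nth sum_distrib_left gb[symmetric]
    by (subst sum.swap) (simp add: mult_ac)
  also have "\<dots> = (\<Sum>k\<le>n. of_real (gkp a b c 0 b' c' n k) * x ^ k) / fact n"
    unfolding gkp_eq_fps_nth[OF assms] sum_divide_distrib
    by (intro sum.cong) (auto simp: gkp_fps_def r_def)
  finally show ?thesis unfolding r_def ..
qed

section \<open>Coefficients at an algebraic singularity\<close>

text \<open>The coefficient of \<open>z ^ n\<close> in \<open>(1 - z) powr (- r)\<close>.\<close>

definition neg_binom_coeff :: "real \<Rightarrow> nat \<Rightarrow> real" where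
  "neg_binom_coeff r n = pochhammer r n / fact n"

lemma neg_binom_coeff_pos: "r > 0 \<Longrightarrow> neg_binom_coeff r n > 0"
  by (simp add: neg_binom_coeff_def pochhammer_pos)

lemma neg_binom_coeff_Suc:
  "neg_binom_coeff r (Suc n) = (r + real n) / real (Suc n) * neg_binom_coeff r n"
  by (simp add: neg_binom_coeff_def pochhammer_Suc)

text \<open>Successive ratios are \<open>(r + n) / (n + 1)\<close>, at least 1 because
  \<open>r \<ge> 1\<close>. This keeps the convolution weights at most 1, as dominated convergence
  requires.\<close>

lemma neg_binom_coeff_mono:
  assumes "r \<ge> 1" "m \<le> n"
  shows "neg_binom_coeff r m \<le> neg_binom_coeff r n"
  using assms(2)
proof (induction rule: dec_induct)
  case (step n)
  have "1 * neg_binom_coeff r n \<le> (r + real n) / real (Suc n) * neg_binom_coeff r n"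
    using assms neg_binom_coeff_pos[of r n] by (intro mult_right_mono) auto
  with step show ?case by (simp add: neg_binom_coeff_Suc)
qed simp

text \<open>Induction on \<open>k\<close>: one further step multiplies by
  \<open>(n - k) / (r + n - k - 1)\<close>, which tends to 1.\<close>

lemma neg_binom_coeff_ratio_tendsto:
  assumes "r > 0"
  shows "(\<lambda>n. neg_binom_coeff r (n - k) / neg_binom_coeff r n) \<longlonglongrightarrow> 1"
proof (induction k)
  case 0
  have "neg_binom_coeff r n / neg_binom_coeff r n = 1" for n
    using neg_binom_coeff_pos[OF assms, of n] by simp
  then show ?case by simp
next
  case (Suc k)
  have "(\<lambda>n. real (n - k) / (r + real (n - Suc k))) \<longlonglongrightarrow> 1"
  proof (rule Lim_transform_eventually)
    show "(\<lambda>n. (real n - real k) / (r + real n - real k - 1)) \<longlonglongrightarrow> 1"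
      by real_asymp
    show "\<forall>\<^sub>F n in sequentially. (real n - real k) / (r + real n - real k - 1) = real (n - k) / (r + real (n - Suc k))"
      using eventually_gt_at_top[of k] by eventually_elim (simp add: of_nat_diff algebra_simps)
  qed
  from tendsto_mult[OF this Suc]
  have lim: "(\<lambda>n. real (n - k) / (r + real (n - Suc k)) * (neg_binom_coeff r (n - k) / neg_binom_coeff r n)) \<longlonglongrightarrow> 1"
    by simp
  show ?case
  proof (rule Lim_transform_eventually[OF lim])
    show "\<forall>\<^sub>F n in sequentially. real (n - k) / (r + real (n - Suc k)) * (neg_binom_coeff r (n - k) / neg_binom_coeff r n)
        = neg_binom_coeff r (n - Suc k) / neg_binom_coeff r n"
      using eventually_gt_at_top[of k]
    proof eventually_elim
      case (elim n)
      then obtain m where m: "n - k = Suc m" "n - Suc k = m"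
        by (metis Suc_diff_Suc)
      have "real (Suc m) / x * (x / real (Suc m) * y / z) = y / z" if "x \<noteq> 0" for x y z :: real
        using that by (simp del: of_nat_Suc)
      moreover have "r + real m \<noteq> 0" using assms by simp
      ultimately show ?case
        unfolding m neg_binom_coeff_Suc by blast
    qed
  qed
qed

text \<open>
  Since \<open>r \<ge> 1\<close>, the coefficients of \<open>(1 - z) powr (- r)\<close> increase, so the coefficients of its
  product with a function holomorphic on a larger disc are governed by dominated convergence.
\<close>

lemma uniform_limit_neg_binom_convolution:
  fixes a :: "complex \<Rightarrow> nat \<Rightarrow> complex"
  assumes r: "r \<ge> 1" and q: "0 \<le> q" "q < 1"
    and a: "\<And>u k. u \<in> S \<Longrightarrow> norm (a u k) \<le> B * q ^ k"
  shows "uniform_limit S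
           (\<lambda>n u. \<Sum>k\<le>n. a u k * of_real (neg_binom_coeff r (n - k) / neg_binom_coeff r n))
           (\<lambda>u. \<Sum>k. a u k) sequentially"
proof (cases "S = {}")
  case False
  \<comment> \<open>Extending the weights by 0 beyond \<open>n\<close> turns the finite sums into
    series over all \<open>k\<close>.\<close>
  define t where "t k n = (if k \<le> n then neg_binom_coeff r (n - k) / neg_binom_coeff r n else 0)" for k n
  have B: "B \<ge> 0"
    using False a[of _ 0] by (metis ex_in_conv mult_1_right norm_ge_zero order_trans power_0)
  have t: "0 \<le> t k n" "t k n \<le> 1" for k n
    using neg_binom_coeff_pos[of r] neg_binom_coeff_mono[OF r, of "n - k" n] r
    by (auto simp: t_def divide_simps less_imp_le)
  have t_lim: "(\<lambda>n. t k n) \<longlonglongrightarrow> 1" for k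
  proof (rule Lim_transform_eventually[OF neg_binom_coeff_ratio_tendsto[of r k]])
    show "\<forall>\<^sub>F n in sequentially. neg_binom_coeff r (n - k) / neg_binom_coeff r n = t k n"
      using eventually_ge_at_top[of k] by eventually_elim (simp add: t_def)
  qed (use r in auto)
  have sq: "summable (\<lambda>k. B * q ^ k)"
    using q by (intro summable_mult summable_geometric) auto
  have bound: "norm (B * q ^ k * (1 - t k n)) \<le> B * q ^ k" for k n
    using t[of k n] B q by (simp add: abs_mult mult_left_le)
  \<comment> \<open>The majorant of the error does not depend on \<open>u\<close>, so a single
    application of Tannery's theorem gives uniformity in \<open>u\<close>.\<close>
  have "(\<lambda>n. \<Sum>k. B * q ^ k * (1 - t k n)) \<longlonglongrightarrow> (\<Sum>k. 0::real)"
  proof (rule tannerys_theorem[THEN conjunct2, THEN conjunct2])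
    show "(\<lambda>n. B * q ^ k * (1 - t k n)) \<longlonglongrightarrow> 0" for k
      by (rule tendsto_eq_intros t_lim refl)+ simp
    show "\<forall>\<^sub>F (k, n) in sequentially \<times>\<^sub>F sequentially. norm (B * q ^ k * (1 - t k n)) \<le> B * q ^ k"
      by (rule always_eventually) (use bound in auto)
  qed (use sq in auto)
  then have lim: "(\<lambda>n. \<Sum>k. B * q ^ k * (1 - t k n)) \<longlonglongrightarrow> 0"
    by simp
  show ?thesis
  proof (rule uniform_limitI)
    fix e :: real assume "e > 0"
    with lim have "\<forall>\<^sub>F n in sequentially. (\<Sum>k. B * q ^ k * (1 - t k n)) < e"
      by (rule order_tendstoD)
    then show "\<forall>\<^sub>F n in sequentially. \<forall>u\<in>S.
      dist (\<Sum>k\<le>n. a u k * of_real (neg_binom_coeff r (n - k) / neg_binom_coeff r n)) (\<Sum>k. a u k) < e"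
    proof eventually_elim
      case (elim n)
      show ?case
      proof
        fix u assume u: "u \<in> S"
        have sa: "summable (a u)"
          by (rule summable_comparison_test'[OF sq]) (use a[OF u] in auto)
        have fin: "(\<lambda>k. a u k * of_real (t k n)) sums (\<Sum>k\<le>n. a u k * of_real (t k n))"
          by (rule sums_finite) (auto simp: t_def)
        have s1: "summable (\<lambda>k. a u k * of_real (1 - t k n))"
          using summable_diff[OF sa sums_summable[OF fin]] by (simp add: algebra_simps)
        have sb: "summable (\<lambda>k. B * q ^ k * (1 - t k n))"
          by (rule summable_comparison_test'[OF sq]) (use bound in auto)
        have "(\<Sum>k. a u k) - (\<Sum>k\<le>n. a u k * of_real (t k n)) = (\<Sum>k. a u k * of_real (1 - t k n))"
          using suminf_diff[OF sa sums_summable[OF fin]] sums_unique[OF fin] by (simp add: algebra_simps)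
        also have "norm \<dots> \<le> (\<Sum>k. B * q ^ k * (1 - t k n))"
        proof (rule norm_suminf_le[OF _ sb])
          fix k show "norm (a u k * of_real (1 - t k n)) \<le> B * q ^ k * (1 - t k n)"
            using a[OF u, of k] t[of k n] unfolding norm_mult norm_of_real using B q by (intro mult_mono) auto
        qed
        finally have "norm ((\<Sum>k. a u k) - (\<Sum>k\<le>n. a u k * of_real (t k n))) < e"
          using elim by linarith
        moreover have "(\<Sum>k\<le>n. a u k * of_real (neg_binom_coeff r (n - k) / neg_binom_coeff r n))
            = (\<Sum>k\<le>n. a u k * of_real (t k n))"
          by (simp add: t_def)
        ultimately show "dist (\<Sum>k\<le>n. a u k * of_real (neg_binom_coeff r (n - k) / neg_binom_coeff r n)) (\<Sum>k. a u k) < e"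
          by (simp add: dist_norm norm_minus_commute)
      qed
    qed
  qed
qed simp

section \<open>Isolating and extracting the singularity\<close>

text \<open>Makes \<open>w = u\<close> the only zero of \<open>L u - L w\<close> in a disc of radius
  \<open>R' > norm p\<close>, quantitatively and uniformly for \<open>u\<close> near
  \<open>p\<close>. Close to \<open>p\<close> this holds since the derivative of \<open>L\<close> is
  nearly constant and nonzero; elsewhere \<open>L - L p\<close> is bounded away from 0 by
  compactness.\<close>

lemma divided_difference_lower_bound:
  fixes L :: "complex \<Rightarrow> complex" and p :: complex
  assumes L: "L holomorphic_on ball 0 R" and p: "0 < norm p" "norm p < R"
    and deriv: "deriv L p \<noteq> 0"
    and uniq: "\<And>w. norm w \<le> norm p \<Longrightarrow> L w = L p \<Longrightarrow> w = p"
  obtains R' \<delta> c where "norm p < R'" "R' < R" "\<delta> > 0" "c > 0"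
    "\<forall>u\<in>ball p \<delta>. \<forall>w. norm w \<le> R' \<longrightarrow> c * norm (u - w) \<le> norm (L u - L w)"
proof -
  define m where "m = norm (deriv L p) / 2"
  have m: "m > 0" using deriv by (simp add: m_def)
  have pin: "p \<in> ball 0 R" using p by simp
  have L': "deriv L holomorphic_on ball 0 R"
    using L by (rule holomorphic_deriv) simp
  then have "isCont (deriv L) p"
    using pin by (meson continuous_on_eq_continuous_at holomorphic_on_imp_continuous_on open_ball)
  then obtain d1 where d1: "d1 > 0" "\<And>z. dist z p < d1 \<Longrightarrow> dist (deriv L z) (deriv L p) < m"
    using m unfolding continuous_at_eps_delta by blast
  define d where "d = min d1 (R - norm p)"
  have d: "d > 0" using d1 p by (simp add: d_def)
  have dR: "ball p d \<subseteq> ball 0 R"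
  proof
    fix z assume "z \<in> ball p d"
    then have "norm (z - p) < R - norm p" by (simp add: d_def dist_norm norm_minus_commute)
    then show "z \<in> ball 0 R" using norm_triangle_ineq[of "z - p" p] by simp
  qed
  \<comment> \<open>\<open>L z - L'(p) z\<close> has derivative of norm at most
    \<open>m = norm (L'(p)) / 2\<close>, so it absorbs at most half of
    \<open>L'(p) (x - y)\<close>.\<close>
  have near: "m * norm (x - y) \<le> norm (L x - L y)" if "x \<in> ball p d" "y \<in> ball p d" for x y
  proof -
    have "norm ((L x - deriv L p * x) - (L y - deriv L p * y)) \<le> m * norm (x - y)"
    proof (rule field_differentiable_bound[of "ball p d" _ "\<lambda>z. deriv L z - deriv L p"])
      fix z assume z: "z \<in> ball p d"
      have "(L has_field_derivative deriv L z) (at z within ball p d)"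
        using holomorphic_derivI[OF L open_ball, of z] z dR has_field_derivative_at_within by blast
      then show "((\<lambda>z. L z - deriv L p * z) has_field_derivative deriv L z - deriv L p) (at z within ball p d)"
        by (auto intro!: derivative_eq_intros)
      show "norm (deriv L z - deriv L p) \<le> m"
        using d1(2)[of z] z by (simp add: d_def dist_norm norm_minus_commute)
    qed (use that in auto)
    moreover have "deriv L p * (x - y) - ((L x - L y) - ((L x - deriv L p * x) - (L y - deriv L p * y))) = 0"
      by (simp add: algebra_simps)
    then have "norm (deriv L p * (x - y)) \<le> norm (L x - L y) + norm ((L x - deriv L p * x) - (L y - deriv L p * y))"
      by (metis eq_iff_diff_eq_0 norm_triangle_ineq4)
    ultimately show ?thesis by (simp add: norm_mult m_def)
  qed
  define R0 where "R0 = (norm p + R) / 2"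
  have R0: "norm p < R0" "R0 < R" using p by (auto simp: R0_def)
  have contL: "continuous_on A L" if "A \<subseteq> ball 0 R" for A
    using L that holomorphic_on_imp_continuous_on continuous_on_subset by blast
  have cball: "cball 0 R1 \<subseteq> ball (0::complex) R" if "R1 \<le> R0" for R1
    using that R0 by (auto simp: subset_iff)
  \<comment> \<open>Further solutions of \<open>L w = L p\<close> in \<open>cball 0 R0\<close> form
    a compact set. By \<open>uniq\<close> one of least norm lies strictly outside the circle through
    \<open>p\<close>, and \<open>R'\<close> is taken halfway; if there are none, \<open>R0\<close>
    itself serves.\<close>
  have "\<exists>R'. norm p < R' \<and> R' \<le> R0 \<and> (\<forall>w. norm w \<le> R' \<longrightarrow> w \<notin> ball p d \<longrightarrow> L w \<noteq> L p)"
  proof -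
    define Z where "Z = {w \<in> cball 0 R0 - ball p d. L w = L p}"
    have "closed Z"
      unfolding Z_def by (intro continuous_closed_preimage_constant contL closed_Diff) (use cball in auto)
    then have Z: "compact Z"
      using compact_Int_closed[OF compact_cball[of 0 R0]] by (simp add: Z_def Int_absorb1 subset_iff compact_eq_bounded_closed bounded_subset[OF bounded_cball[of 0 R0]])
    show ?thesis
    proof (cases "Z = {}")
      case True
      then show ?thesis using R0 by (intro exI[of _ R0]) (auto simp: Z_def)
    next
      case False
      then obtain z0 where z0: "z0 \<in> Z" "\<And>z. z \<in> Z \<Longrightarrow> norm z0 \<le> norm z"
        using continuous_attains_inf[OF Z, of norm] continuous_on_norm_id by blast
      have "norm p < norm z0"
      proof (rule ccontr)
        assume "\<not> norm p < norm z0"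
        then have "z0 = p" using uniq z0(1) by (auto simp: Z_def)
        then show False using z0(1) d by (simp add: Z_def)
      qed
      moreover have "norm z0 \<le> R0" using z0(1) by (simp add: Z_def)
      moreover have "L w \<noteq> L p" if "norm w \<le> (norm p + norm z0) / 2" "w \<notin> ball p d" for w
        using z0(2)[of w] that calculation by (auto simp: Z_def)
      ultimately show ?thesis by (intro exI[of _ "(norm p + norm z0) / 2"]) auto
    qed
  qed
  then obtain R' where R': "norm p < R'" "R' \<le> R0"
    and far: "\<And>w. norm w \<le> R' \<Longrightarrow> w \<notin> ball p d \<Longrightarrow> L w \<noteq> L p"
    by blast
  have "\<exists>e>0. \<forall>w. norm w \<le> R' \<longrightarrow> w \<notin> ball p d \<longrightarrow> e \<le> norm (L p - L w)"
  proof (cases "cball 0 R' - ball p d = {}")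
    case True
    then show ?thesis by (intro exI[of _ 1]) auto
  next
    case False
    have "compact (cball 0 R' - ball p d)" by (intro compact_diff) auto
    moreover have "continuous_on (cball 0 R' - ball p d) (\<lambda>w. norm (L p - L w))"
      using cball[OF R'(2)] by (intro continuous_intros contL) auto
    ultimately obtain w0 where w0: "w0 \<in> cball 0 R' - ball p d"
      "\<And>w. w \<in> cball 0 R' - ball p d \<Longrightarrow> norm (L p - L w0) \<le> norm (L p - L w)"
      using continuous_attains_inf[OF _ False] by blast
    then show ?thesis using far[of w0] by (intro exI[of _ "norm (L p - L w0)"]) auto
  qed
  then obtain e where e: "e > 0" "\<And>w. norm w \<le> R' \<Longrightarrow> w \<notin> ball p d \<Longrightarrow> e \<le> norm (L p - L w)"
    by blast
  have "isCont L p"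
    using L pin by (meson continuous_on_eq_continuous_at holomorphic_on_imp_continuous_on open_ball)
  then obtain d2 where d2: "d2 > 0" "\<And>z. dist z p < d2 \<Longrightarrow> dist (L z) (L p) < e / 2"
    using e(1) unfolding continuous_at_eps_delta by (meson half_gt_zero)
  define \<delta> where "\<delta> = min d d2"
  \<comment> \<open>Away from \<open>p\<close> the gap \<open>e\<close> is still at least
    \<open>e / 2\<close> after \<open>p\<close> is moved to \<open>u\<close>, and
    \<open>norm (u - w) \<le> 2 * R\<close>; hence the constant \<open>e / (4 * R)\<close>.\<close>
  define c where "c = min m (e / (4 * R))"
  have R: "R > 0" using p by linarith
  show ?thesis
  proof (rule that[of R' \<delta> c])
    show "\<forall>u\<in>ball p \<delta>. \<forall>w. norm w \<le> R' \<longrightarrow> c * norm (u - w) \<le> norm (L u - L w)"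
    proof (intro ballI allI impI)
      fix u w :: complex assume u: "u \<in> ball p \<delta>" and w: "norm w \<le> R'"
      show "c * norm (u - w) \<le> norm (L u - L w)"
      proof (cases "w \<in> ball p d")
        case True
        have "c * norm (u - w) \<le> m * norm (u - w)"
          by (intro mult_right_mono) (auto simp: c_def)
        also have "\<dots> \<le> norm (L u - L w)" using near[of u w] True u by (simp add: \<delta>_def)
        finally show ?thesis .
      next
        case False
        have "u \<in> ball 0 R" using u dR by (auto simp: \<delta>_def)
        then have uw: "norm (u - w) \<le> 2 * R"
          using w R' R0 norm_triangle_ineq4[of u w] by simp
        have "c * norm (u - w) \<le> e / (4 * R) * (2 * R)"
          using e R by (intro mult_mono uw) (auto simp: c_def)
        also have "\<dots> = e / 2" using R by simp
        also have "\<dots> \<le> norm (L p - L w) - norm (L u - L p)"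
          using e(2)[OF w False] d2(2)[of u] u by (simp add: \<delta>_def dist_norm norm_minus_commute)
        also have "\<dots> \<le> norm (L u - L w)"
          using norm_triangle_ineq4[of "L u - L w" "L u - L p"] by (simp add: algebra_simps)
        finally show ?thesis .
      qed
    qed
  qed (use R' R0 d d2 m e R in \<open>auto simp: \<delta>_def c_def\<close>)
qed

text \<open>Since \<open>L u - L w\<close> vanishes only at \<open>w = u\<close>, and simply,
  \<open>1 - L w / L u = (1 - w / u) k(w)\<close> with \<open>k\<close> zero-free. Hence
  \<open>k = exp g\<close>, and \<open>W = E exp (- r g)\<close>. The bound on \<open>W\<close> is
  explicit in \<open>u\<close> so that it can be made uniform later.\<close>

lemma singular_factor:
  fixes L E :: "complex \<Rightarrow> complex"
  assumes L: "L holomorphic_on ball 0 R" "L has_fps_expansion LF" "fps_nth LF 0 = 0"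
    and E: "E holomorphic_on ball 0 R" "E has_fps_expansion EF"
    and u: "u \<noteq> 0" "norm u < R'" and R: "R' < R" and c: "c > 0" and r: "r \<ge> 0"
    and lower: "\<And>w. norm w \<le> R' \<Longrightarrow> c * norm (u - w) \<le> norm (L u - L w)"
  obtains W where "W holomorphic_on ball 0 R'"
    "\<And>w. w \<in> ball 0 R' \<Longrightarrow> norm (W w) \<le> norm (E w) * (c * norm u / norm (L u)) powr (- r)"
    "\<And>w. w \<in> ball 0 R' \<Longrightarrow> E w \<noteq> 0 \<Longrightarrow> W w \<noteq> 0"
    "EF * (fps_binomial (- of_real r) oo (fps_const (- (1 / L u)) * LF)) =
     (fps_binomial (- of_real r) oo (fps_const (- (1 / u)) * fps_X)) * fps_expansion W 0"
proof -
  have L0: "L 0 = 0"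
    using has_fps_expansion_imp_0_eq_fps_nth_0[OF L(2)] L(3) by simp
  have R': "R' > 0" using u by (smt (verit) norm_ge_zero)
  have Lu: "L u \<noteq> 0"
    using lower[of 0] R' c u by (auto simp: L0 mult_le_0_iff)
  have sub: "ball 0 R' \<subseteq> ball (0::complex) R" using R by auto
  define dd where "dd w = (if w = u then deriv L u else (L w - L u) / (w - u))" for w
  define k where "k w = u / L u * dd w" for w
  have dd_holo: "dd holomorphic_on ball 0 R'"
    unfolding dd_def using pole_lemma_open[OF L(1) open_ball, of u] sub holomorphic_on_subset by blast
  have dd_ge: "c \<le> norm (dd w)" if w: "w \<in> ball 0 R'" for w
  proof (cases "w = u")
    case False
    then show ?thesis using lower[of w] w
      by (simp add: dd_def norm_divide divide_simps norm_minus_commute)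
  next
    case True
    \<comment> \<open>At \<open>w = u\<close> the bound is inherited from nearby points by
      continuity.\<close>
    have "isCont dd w"
      using dd_holo w by (meson continuous_on_eq_continuous_at holomorphic_on_imp_continuous_on open_ball)
    then have "((\<lambda>w. norm (dd w)) \<longlongrightarrow> norm (dd w)) (at w)"
      unfolding isCont_def by (rule tendsto_norm)
    moreover have "\<forall>\<^sub>F v in at w. c \<le> norm (dd v)"
    proof -
      have "\<forall>\<^sub>F v in at w. v \<in> ball 0 R' - {w}"
        using w by (intro eventually_at_in_open) auto
      then show ?thesis
      proof eventually_elim
        case (elim v)
        then show ?case using lower[of v] True
          by (auto simp: dd_def norm_divide divide_simps norm_minus_commute)
      qed
    qed
    ultimately show ?thesis by (rule tendsto_lowerbound) simp
  qed
  have k_holo: "k holomorphic_on ball 0 R'"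
    unfolding k_def by (intro holomorphic_intros dd_holo) (use Lu in auto)
  have k_ge: "c * norm u / norm (L u) \<le> norm (k w)" if "w \<in> ball 0 R'" for w
    using mult_left_mono[OF dd_ge[OF that], of "norm u / norm (L u)"]
    by (simp add: k_def norm_mult norm_divide mult_ac)
  have pos: "c * norm u / norm (L u) > 0" using c u Lu by simp
  obtain g0 where g0: "g0 holomorphic_on ball 0 R'" "\<And>w. w \<in> ball 0 R' \<Longrightarrow> exp (g0 w) = k w"
    by (rule holomorphic_logarithm_exists[OF convex_ball open_ball k_holo, of 0])
       (use k_ge pos R' in fastforce)+
  \<comment> \<open>Subtracting the constant makes \<open>g 0 = 0\<close>, which picks the branch
    agreeing with the principal powers at 0; \<open>exp g = k\<close> survives because
    \<open>k 0 = 1\<close>.\<close>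
  define g where "g w = g0 w - g0 0" for w
  have "k 0 = 1" using u(1) Lu by (simp add: k_def dd_def L0)
  then have g: "exp (g w) = k w" if "w \<in> ball 0 R'" for w
    using g0(2)[OF that] g0(2)[of 0] R' by (simp add: g_def exp_diff)
  have g_holo: "g holomorphic_on ball 0 R'"
    unfolding g_def by (intro holomorphic_intros g0)
  have g_0: "g 0 = 0" by (simp add: g_def)
  define W where "W w = E w * exp (- of_real r * g w)" for w
  have W_holo: "W holomorphic_on ball 0 R'"
    unfolding W_def using E(1) sub by (intro holomorphic_intros g_holo) (rule holomorphic_on_subset)
  show ?thesis
  proof (rule that[of W])
    show "W holomorphic_on ball 0 R'" by fact
    show "W w \<noteq> 0" if "E w \<noteq> 0" for w using that by (simp add: W_def)
    show "norm (W w) \<le> norm (E w) * (c * norm u / norm (L u)) powr (- r)" if w: "w \<in> ball 0 R'" for w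
    proof -
      have "norm (k w) = exp (Re (g w))" using g[OF w] by (metis norm_exp_eq_Re)
      then have "norm (exp (- of_real r * g w)) = norm (k w) powr (- r)"
        by (simp add: powr_def)
      also have "\<dots> \<le> (c * norm u / norm (L u)) powr (- r)"
        using r pos k_ge[OF w] by (intro powr_mono2') auto
      finally show ?thesis by (simp add: W_def norm_mult mult_left_mono)
    qed
    have exp1: "(\<lambda>w. E w * (1 - L w / L u) powr (- of_real r)) has_fps_expansion
        (EF * (fps_binomial (- of_real r) oo (fps_const (- (1 / L u)) * LF)))"
    proof -
      have "(\<lambda>w. - (1 / L u) * L w) has_fps_expansion fps_const (- (1 / L u)) * LF"
        by (intro fps_expansion_intros L)
      from has_fps_expansion_compose[OF has_fps_expansion_binomial_complex[of "- of_real r"] this]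
      have "((\<lambda>x. (1 + x) powr (- of_real r)) \<circ> (\<lambda>w. - (1 / L u) * L w)) has_fps_expansion
          (fps_binomial (- of_real r) oo (fps_const (- (1 / L u)) * LF))"
        using L(3) by simp
      from has_fps_expansion_mult[OF E(2) this] show ?thesis
        by (simp add: o_def)
    qed
    have exp2: "(\<lambda>w. (1 - w / u) powr (- of_real r) * W w) has_fps_expansion
        ((fps_binomial (- of_real r) oo (fps_const (- (1 / u)) * fps_X)) * fps_expansion W 0)"
    proof -
      have "(\<lambda>w. - (1 / u) * w) has_fps_expansion fps_const (- (1 / u)) * fps_X"
        by (intro fps_expansion_intros)
      from has_fps_expansion_compose[OF has_fps_expansion_binomial_complex[of "- of_real r"] this]
      have *: "((\<lambda>x. (1 + x) powr (- of_real r)) \<circ> (\<lambda>w. - (1 / u) * w)) has_fps_expansion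
          (fps_binomial (- of_real r) oo (fps_const (- (1 / u)) * fps_X))"
        by simp
      have "W has_fps_expansion fps_expansion W 0"
        using R' by (intro has_fps_expansion_fps_expansion[OF _ _ W_holo]) auto
      from has_fps_expansion_mult[OF * this] show ?thesis
        by (simp add: o_def)
    qed
    have "\<forall>\<^sub>F w in nhds 0. E w * (1 - L w / L u) powr (- of_real r) = (1 - w / u) powr (- of_real r) * W w"
    proof -
      \<comment> \<open>\<open>s\<close> is a logarithm of \<open>1 - L w / L u\<close>. By
        continuity its imaginary part stays between \<open>- pi\<close> and \<open>pi\<close> near
        0, so it is the principal one and the principal powers multiply there.\<close>
      define s where "s w = g w + Ln (1 - w / u)" for w
      have "isCont g 0"
        using g_holo R' by (meson continuous_on_eq_continuous_at holomorphic_on_imp_continuous_on open_ball centre_in_ball)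
      then have "isCont s 0"
        unfolding s_def using u by (intro continuous_intros) auto
      then have "((\<lambda>w. Im (s w)) \<longlongrightarrow> Im (s 0)) (nhds 0)"
        by (intro tendsto_Im) (simp add: isCont_def tendsto_at_iff_tendsto_nhds)
      then have "((\<lambda>w. Im (s w)) \<longlongrightarrow> 0) (nhds 0)"
        by (simp add: s_def g_0)
      then have "\<forall>\<^sub>F w in nhds 0. - pi < Im (s w)" "\<forall>\<^sub>F w in nhds 0. Im (s w) < pi"
        by (auto intro: order_tendstoD)
      moreover have "\<forall>\<^sub>F w in nhds 0. w \<in> ball 0 (min (norm u) R')"
        using u R' by (intro eventually_nhds_in_open) auto
      ultimately show ?thesis
      proof eventually_elim
        case (elim w)
        then have wu: "w \<noteq> u" "w \<in> ball 0 R'" by auto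
        then have nz: "1 - w / u \<noteq> 0" using u by (simp add: field_simps)
        have eq: "exp (s w) = 1 - L w / L u"
        proof -
          have "exp (s w) = k w * (1 - w / u)"
            unfolding s_def exp_add using g[OF wu(2)] nz by simp
          also have "\<dots> = 1 - L w / L u"
            using wu u Lu by (simp add: k_def dd_def divide_simps) (simp add: algebra_simps)
          finally show ?thesis .
        qed
        then have nz2: "1 - L w / L u \<noteq> 0" by (metis exp_not_eq_zero)
        have "Ln (1 - L w / L u) = s w"
          using elim by (simp flip: eq)
        then have "(1 - L w / L u) powr (- of_real r) = exp (- of_real r * s w)"
          using nz2 by (simp add: powr_def)
        also have "\<dots> = exp (- of_real r * g w) * (1 - w / u) powr (- of_real r)"
          using nz by (simp add: s_def powr_def ring_distribs exp_add exp_diff exp_minus field_simps)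
        finally show ?case by (simp add: W_def)
      qed
    qed
    from exp1[unfolded has_fps_expansion_cong[OF this refl]] exp2
    show "EF * (fps_binomial (- of_real r) oo (fps_const (- (1 / L u)) * LF)) =
     (fps_binomial (- of_real r) oo (fps_const (- (1 / u)) * fps_X)) * fps_expansion W 0"
      by (rule fps_expansion_unique_complex)
  qed
qed

text \<open>By \<open>singular_factor\<close> the coefficient is a convolution of those of
  \<open>(1 - w / u) powr (- r)\<close> and of \<open>W u\<close>; Cauchy's estimate makes the
  latter decay geometrically, uniformly in \<open>u\<close>. The limit at \<open>p\<close> is
  \<open>W p p\<close>, nonzero because \<open>E p\<close> is.\<close>

theorem algebraic_singularity_uniform_limit:
  fixes L E :: "complex \<Rightarrow> complex" and p :: complex
  assumes L: "L holomorphic_on ball 0 R" "L has_fps_expansion LF" "fps_nth LF 0 = 0"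
    and E: "E holomorphic_on ball 0 R" "E has_fps_expansion EF" "E p \<noteq> 0"
    and p: "0 < norm p" "norm p < R" and r: "r \<ge> 1"
    and deriv: "deriv L p \<noteq> 0"
    and uniq: "\<And>w. norm w \<le> norm p \<Longrightarrow> L w = L p \<Longrightarrow> w = p"
  obtains \<delta> Q where "\<delta> > 0" "ball p \<delta> \<subseteq> ball 0 R" "\<And>u. u \<in> ball p \<delta> \<Longrightarrow> u \<noteq> 0 \<and> L u \<noteq> 0" "Q p \<noteq> 0"
    "uniform_limit (ball p \<delta>)
       (\<lambda>n u. fps_nth (EF * (fps_binomial (- of_real r) oo (fps_const (- (1 / L u)) * LF))) n
          * u ^ n / of_real (neg_binom_coeff r n)) Q sequentially"
proof -
  obtain R' d c where R': "norm p < R'" "R' < R" and d: "d > 0" and c: "c > 0"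
    and lower: "\<And>u w. u \<in> ball p d \<Longrightarrow> norm w \<le> R' \<Longrightarrow> c * norm (u - w) \<le> norm (L u - L w)"
    using divided_difference_lower_bound[OF L(1) p deriv uniq] by metis
  \<comment> \<open>The points \<open>u\<close> stay within \<open>R1\<close> while
    \<open>W u\<close> is bounded on the larger disc of radius \<open>R2\<close>; the quotient
    \<open>R1 / R2\<close> is the geometric rate \<open>q\<close>.\<close>
  define R1 where "R1 = (norm p + R') / 2"
  define R2 where "R2 = (R1 + R') / 2"
  have R12: "norm p < R1" "R1 < R2" "R2 < R'" "0 < R1" "0 < R2"
    using R' p(1) unfolding R1_def R2_def by (simp_all add: field_simps del: zero_less_norm_iff)
  \<comment> \<open>The bound \<open>norm p / 2\<close> keeps \<open>u\<close> away from 0, and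
    \<open>R1 - norm p\<close> keeps it inside radius \<open>R1\<close>.\<close>
  define \<delta> where "\<delta> = min d (min (norm p / 2) (R1 - norm p))"
  have \<delta>: "\<delta> > 0" "\<delta> \<le> d" "\<delta> \<le> norm p / 2" "\<delta> \<le> R1 - norm p"
    using d p R12 by (simp_all add: \<delta>_def del: le_divide_eq_numeral1)
  have L0: "L 0 = 0"
    using has_fps_expansion_imp_0_eq_fps_nth_0[OF L(2)] L(3) by simp
  have u_bounds: "norm p / 2 \<le> norm u" "norm u < R1" "u \<noteq> 0" "L u \<noteq> 0" if "u \<in> ball p \<delta>" for u
  proof -
    have *: "norm (u - p) < \<delta>" using that by (simp add: dist_norm norm_minus_commute)
    show 1: "norm p / 2 \<le> norm u"
      using * \<delta>(3) norm_triangle_ineq2[of p u] by (simp add: norm_minus_commute)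
    show "norm u < R1" using * \<delta>(4) norm_triangle_ineq2[of u p] by simp
    show 2: "u \<noteq> 0" using 1 p by auto
    show "L u \<noteq> 0"
      using lower[of u 0] that \<delta>(2) R12 R' c 2 by (auto simp: L0 mult_le_0_iff)
  qed
  define P where "P u = EF * (fps_binomial (- of_real r) oo (fps_const (- (1 / L u)) * LF))" for u
  define T where "T u = fps_binomial (- of_real r) oo (fps_const (- (1 / u)) * fps_X)" for u :: complex
  define good where "good u W \<longleftrightarrow> W holomorphic_on ball 0 R' \<and>
    (\<forall>w\<in>ball 0 R'. norm (W w) \<le> norm (E w) * (c * norm u / norm (L u)) powr (- r)) \<and>
    (\<forall>w\<in>ball 0 R'. E w \<noteq> 0 \<longrightarrow> W w \<noteq> 0) \<and> P u = T u * fps_expansion W 0" for u W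
  have "\<exists>W. good u W" if u: "u \<in> ball p \<delta>" for u
  proof -
    have "u \<in> ball p d" using u \<delta> by auto
    obtain W where "W holomorphic_on ball 0 R'"
    "\<And>w. w \<in> ball 0 R' \<Longrightarrow> norm (W w) \<le> norm (E w) * (c * norm u / norm (L u)) powr (- r)"
    "\<And>w. w \<in> ball 0 R' \<Longrightarrow> E w \<noteq> 0 \<Longrightarrow> W w \<noteq> 0"
    "P u = T u * fps_expansion W 0"
      unfolding P_def T_def
      by (rule singular_factor[OF L E(1,2), of u R' c r])
         (use u_bounds[OF u] R' R12 c r lower[OF \<open>u \<in> ball p d\<close>] in auto)
    then show ?thesis unfolding good_def by blast
  qed
  then obtain W where "\<And>u. u \<in> ball p \<delta> \<Longrightarrow> good u (W u)"
    by metis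
  then have W: "\<And>u. u \<in> ball p \<delta> \<Longrightarrow> W u holomorphic_on ball 0 R'"
    "\<And>u w. u \<in> ball p \<delta> \<Longrightarrow> w \<in> ball 0 R' \<Longrightarrow> norm (W u w) \<le> norm (E w) * (c * norm u / norm (L u)) powr (- r)"
    "\<And>u w. u \<in> ball p \<delta> \<Longrightarrow> w \<in> ball 0 R' \<Longrightarrow> E w \<noteq> 0 \<Longrightarrow> W u w \<noteq> 0"
    "\<And>u. u \<in> ball p \<delta> \<Longrightarrow> P u = T u * fps_expansion (W u) 0"
    unfolding good_def by blast+
  have sub: "cball 0 R1 \<subseteq> ball (0::complex) R" "cball 0 R2 \<subseteq> ball (0::complex) R" "cball 0 R2 \<subseteq> ball (0::complex) R'"
    using R12 R' by auto
  have bdd: "\<exists>B>0. \<forall>w\<in>cball 0 s. norm (f w) \<le> B" if "f holomorphic_on ball 0 R" "cball (0::complex) s \<subseteq> ball 0 R"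
    for f :: "complex \<Rightarrow> complex" and s
  proof -
    have "f holomorphic_on cball 0 s" using that by (rule holomorphic_on_subset)
    then have "compact (f ` cball 0 s)"
      by (intro compact_continuous_image holomorphic_on_imp_continuous_on compact_cball)
    from compact_imp_bounded[OF this] show ?thesis unfolding bounded_pos by auto
  qed
  obtain BL where BL: "BL > 0" "\<And>w. norm w \<le> R1 \<Longrightarrow> norm (L w) \<le> BL"
    using bdd[OF L(1) sub(1)] by auto
  obtain BE where BE: "BE > 0" "\<And>w. norm w \<le> R2 \<Longrightarrow> norm (E w) \<le> BE"
    using bdd[OF E(1) sub(2)] by auto
  define B where "B = BE * (c * (norm p / 2) / BL) powr (- r)"
  define q where "q = R1 / R2"
  have q: "0 \<le> q" "q < 1" using R12 by (auto simp: q_def)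
  have W_bound: "norm (W u w) \<le> B" if u: "u \<in> ball p \<delta>" and w: "norm w \<le> R2" for u w
  proof -
    have "norm (W u w) \<le> norm (E w) * (c * norm u / norm (L u)) powr (- r)"
      using W(2)[OF u, of w] w R12 by simp
    also have "\<dots> \<le> BE * (c * (norm p / 2) / BL) powr (- r)"
    proof (intro mult_mono BE(2)[OF w] powr_mono2')
      show "c * (norm p / 2) / BL \<le> c * norm u / norm (L u)"
        using u_bounds[OF u] c p BL by (intro frac_le mult_left_mono) auto
    qed (use r c p BL BE in auto)
    finally show ?thesis by (simp add: B_def)
  qed
  define a where "a u k = fps_nth (fps_expansion (W u) 0) k * u ^ k" for u k
  have a_bound: "norm (a u k) \<le> B * q ^ k" if u: "u \<in> ball p \<delta>" for u k
  proof -
    have "norm ((deriv ^^ k) (W u) 0) \<le> fact k * B / R2 ^ k"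
    proof (rule Cauchy_inequality)
      show "W u holomorphic_on ball 0 R2"
        using W(1)[OF u] by (rule holomorphic_on_subset) (use R12 in auto)
      show "continuous_on (cball 0 R2) (W u)"
        using W(1)[OF u] sub(3) by (meson holomorphic_on_imp_continuous_on holomorphic_on_subset)
    qed (use R12 W_bound[OF u] in auto)
    then have "norm (fps_nth (fps_expansion (W u) 0) k) \<le> B / R2 ^ k"
      using R12 by (simp add: fps_expansion_def norm_divide field_simps)
    moreover have "norm (u ^ k) \<le> R1 ^ k"
      unfolding norm_power by (intro power_mono) (use u_bounds[OF u] in auto)
    moreover have "0 \<le> B" using W_bound[OF u, of 0] R12 by (smt (verit) norm_ge_zero norm_zero)
    ultimately have "norm (a u k) \<le> B / R2 ^ k * R1 ^ k"
      unfolding a_def norm_mult using R12 by (intro mult_mono) auto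
    then show ?thesis by (simp add: q_def power_divide)
  qed
  have coeff: "fps_nth (P u) n * u ^ n / of_real (neg_binom_coeff r n)
      = (\<Sum>k\<le>n. a u k * of_real (neg_binom_coeff r (n - k) / neg_binom_coeff r n))" if u: "u \<in> ball p \<delta>" for u n
  proof -
    \<comment> \<open>Multiplication by \<open>u ^ j\<close> removes the scaling in
      \<open>(1 - w / u) powr (- r)\<close>, leaving coefficients independent of
      \<open>u\<close>.\<close>
    have T: "fps_nth (T u) j * u ^ j = of_real (neg_binom_coeff r j)" for j
    proof -
      have "fps_nth (T u) j * u ^ j = ((- 1) ^ j * (- 1) ^ j) * of_real (neg_binom_coeff r j) * ((1 / u) ^ j * u ^ j)"
        unfolding T_def fps_compose_linear fps_nth_Abs_fps fps_binomial_nth gbinomial_pochhammer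
          power_minus[of "1 / u" j] minus_minus neg_binom_coeff_def
        by (simp add: mult_ac pochhammer_of_real)
      also have "(- 1) ^ j * (- 1) ^ j = (1::complex)" by (simp flip: power_mult_distrib)
      also have "(1 / u) ^ j * u ^ j = 1" using u_bounds[OF u] by (simp flip: power_mult_distrib)
      finally show ?thesis by simp
    qed
    have "fps_nth (P u) n * u ^ n = (\<Sum>k\<le>n. fps_nth (fps_expansion (W u) 0) k * fps_nth (T u) (n - k) * (u ^ k * u ^ (n - k)))"
      unfolding W(4)[OF u] mult.commute[of "T u"] fps_mult_nth atLeast0AtMost sum_distrib_right
      by (intro sum.cong refl arg_cong2[of _ _ _ _ "(*)"]) (simp flip: power_add)
    also have "\<dots> = (\<Sum>k\<le>n. a u k * of_real (neg_binom_coeff r (n - k)))"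
      unfolding a_def T[symmetric] by (intro sum.cong) (simp_all only: mult_ac)
    finally show ?thesis by (simp add: sum_divide_distrib)
  qed
  show ?thesis
  proof (rule that[of \<delta> "\<lambda>u. \<Sum>k. a u k"])
    show "ball p \<delta> \<subseteq> ball 0 R"
      using u_bounds(2) R12 R' by force
    show "(\<Sum>k. a p k) \<noteq> 0"
    proof -
      have pin: "p \<in> ball p \<delta>" using \<delta> by simp
      \<comment> \<open>The limit series at \<open>p\<close> is the Taylor series of
        \<open>W p\<close>, which converges there as \<open>norm p < R'\<close>.\<close>
      have "W p holomorphic_on eball 0 (ereal R')" using W(1)[OF pin] by simp
      from eval_fps_expansion'[OF this, of p] have "(\<Sum>k. a p k) = W p p"
        using R' by (simp add: eval_fps_def a_def)
      then show ?thesis using W(3)[OF pin, of p] E(3) R' by simp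
    qed
    show "uniform_limit (ball p \<delta>)
       (\<lambda>n u. fps_nth (EF * (fps_binomial (- of_real r) oo (fps_const (- (1 / L u)) * LF))) n
          * u ^ n / of_real (neg_binom_coeff r n)) (\<lambda>u. \<Sum>k. a u k) sequentially"
      unfolding P_def[symmetric]
      by (subst uniform_limit_cong'[OF coeff refl], assumption)
         (rule uniform_limit_neg_binom_convolution[OF r q, of "ball p \<delta>" a B], rule a_bound)
  qed (use \<delta> u_bounds in auto)
qed

section \<open>Quasi-powers\<close>

text \<open>Taylor expansion to second order: the cubic remainder times \<open>c n\<close> is at
  most a constant times \<open>norm (c n * z n ^ 2) * norm (z n)\<close>, which tends to 0. It is
  applied with \<open>c n = n\<close> and \<open>z n\<close> of order
  \<open>1 / sqrt n\<close>.\<close>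

lemma holomorphic_second_order:
  fixes K :: "complex \<Rightarrow> complex" and z c :: "nat \<Rightarrow> complex"
  assumes K: "K holomorphic_on ball 0 \<delta>" "\<delta> > 0" "K 0 = 0"
    and z: "z \<longlonglongrightarrow> 0" and cz: "(\<lambda>n. c n * z n ^ 2) \<longlonglongrightarrow> w"
  shows "(\<lambda>n. c n * (K (z n) - deriv K 0 * z n)) \<longlonglongrightarrow> deriv (deriv K) 0 * w / 2"
proof -
  let ?S = "cball 0 (\<delta> / 2)"
  have sub: "?S \<subseteq> ball (0::complex) \<delta>" using K by auto
  have hol: "(deriv ^^ i) K holomorphic_on ball 0 \<delta>" for i
    using K by (intro holomorphic_higher_deriv) auto
  have "(deriv ^^ 3) K holomorphic_on ?S"
    using hol sub by (rule holomorphic_on_subset)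
  then have "compact ((deriv ^^ 3) K ` ?S)"
    by (intro compact_continuous_image holomorphic_on_imp_continuous_on compact_cball)
  from compact_imp_bounded[OF this] obtain B where B: "\<And>x. x \<in> ?S \<Longrightarrow> norm ((deriv ^^ 3) K x) \<le> B"
    unfolding bounded_iff by blast
  have taylor: "norm (K x - (deriv K 0 * x + deriv (deriv K) 0 * x ^ 2 / 2)) \<le> B / 2 * norm x ^ 3" if "x \<in> ?S" for x
  proof -
    have "norm ((deriv ^^ 0) K x - (\<Sum>i\<le>2. (deriv ^^ i) K 0 * (x - 0) ^ i / fact i))
       \<le> B * norm (x - 0) ^ Suc 2 / fact 2"
    proof (rule complex_Taylor[of ?S])
      fix i and y :: complex assume "y \<in> ?S"
      then show "((deriv ^^ i) K has_field_derivative (deriv ^^ Suc i) K y) (at y within ?S)"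
        using holomorphic_derivI[OF hol[of i] open_ball, of y] sub has_field_derivative_at_within by fastforce
    qed (use B K that in \<open>auto simp: numeral_3_eq_3 numeral_2_eq_2\<close>)
    then show ?thesis
      using K(3) by (simp add: numeral_2_eq_2 numeral_3_eq_3 algebra_simps)
  qed
  define e where "e n = c n * (K (z n) - (deriv K 0 * z n + deriv (deriv K) 0 * z n ^ 2 / 2))" for n
  have "e \<longlonglongrightarrow> 0"
  proof (rule Lim_null_comparison)
    have "\<forall>\<^sub>F n in sequentially. z n \<in> ball 0 (\<delta> / 2)"
      using z K by (intro topological_tendstoD[OF z]) auto
    then show "\<forall>\<^sub>F n in sequentially. norm (e n) \<le> B / 2 * norm (c n * z n ^ 2) * norm (z n)"
    proof eventually_elim
      case (elim n)
      have "norm (e n) \<le> norm (c n) * (B / 2 * norm (z n) ^ 3)"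
        unfolding e_def norm_mult using elim by (intro mult_left_mono taylor) auto
      then show ?case by (simp add: norm_mult norm_power power3_eq_cube power2_eq_square mult_ac)
    qed
    show "(\<lambda>n. B / 2 * norm (c n * z n ^ 2) * norm (z n)) \<longlonglongrightarrow> 0"
      using tendsto_mult[OF tendsto_mult[OF tendsto_const[of "B / 2"] tendsto_norm[OF cz]] tendsto_norm[OF z]] by simp
  qed
  from tendsto_add[OF this tendsto_mult[OF tendsto_const[of "deriv (deriv K) 0 / 2"] cz]]
  have "(\<lambda>n. e n + deriv (deriv K) 0 / 2 * (c n * z n ^ 2)) \<longlonglongrightarrow> deriv (deriv K) 0 * w / 2"
    by simp
  moreover have "e n + deriv (deriv K) 0 / 2 * (c n * z n ^ 2) = c n * (K (z n) - deriv K 0 * z n)" for n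
    by (simp add: e_def algebra_simps)
  ultimately show ?thesis by simp
qed

text \<open>The hypotheses of Hwang's quasi-powers theorem.\<close>

locale quasi_powers =
  fixes p :: "nat \<Rightarrow> nat \<Rightarrow> real" and K R :: "complex \<Rightarrow> complex" and \<delta> m v :: real
  assumes sum_p: "\<And>n. (\<Sum>k\<le>n. p n k) = 1"
    and \<delta>: "\<delta> > 0"
    and K: "K holomorphic_on ball 0 \<delta>" "K 0 = 0"
    and K1: "deriv K 0 = of_real m" and K2: "deriv (deriv K) 0 = of_real v"
    and lim: "uniform_limit (ball 0 \<delta>)
      (\<lambda>n s. (\<Sum>k\<le>n. of_real (p n k) * exp (of_nat k * s)) * exp (- of_nat n * K s)) R sequentially"
begin

definition mgf :: "nat \<Rightarrow> complex \<Rightarrow> complex" where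
  "mgf n s = (\<Sum>k\<le>n. of_real (p n k) * exp (of_nat k * s))"

text \<open>What remains of the moment generating function after removal of
  \<open>exp (n K(s))\<close>; its derivatives at 0 carry the bounded errors of mean and
  variance.\<close>

definition R\<^sub>n :: "nat \<Rightarrow> complex \<Rightarrow> complex" where
  "R\<^sub>n n s = mgf n s * exp (- of_nat n * K s)"

definition mean :: "nat \<Rightarrow> real" where "mean n = (\<Sum>k\<le>n. p n k * real k)"

definition var :: "nat \<Rightarrow> real" where "var n = (\<Sum>k\<le>n. p n k * (real k - mean n) ^ 2)"

lemma Rn_lim: "uniform_limit (ball 0 \<delta>) R\<^sub>n R sequentially"
  using lim by (simp add: R\<^sub>n_def[abs_def] mgf_def)

lemma K_deriv: "s \<in> ball 0 \<delta> \<Longrightarrow> (K has_field_derivative deriv K s) (at s)"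
  using holomorphic_derivI[OF K(1) open_ball] by blast

lemma K_deriv2: "s \<in> ball 0 \<delta> \<Longrightarrow> (deriv K has_field_derivative deriv (deriv K) s) (at s)"
  using holomorphic_derivI[OF holomorphic_deriv[OF K(1) open_ball] open_ball] by blast

definition mgf' :: "nat \<Rightarrow> complex \<Rightarrow> complex" where
  "mgf' n s = (\<Sum>k\<le>n. of_real (p n k * real k) * exp (of_nat k * s))"

definition mgf'' :: "nat \<Rightarrow> complex \<Rightarrow> complex" where
  "mgf'' n s = (\<Sum>k\<le>n. of_real (p n k * real k ^ 2) * exp (of_nat k * s))"

lemma mgf_deriv: "(mgf n has_field_derivative mgf' n s) (at s)"
  unfolding mgf_def[abs_def] mgf'_def
  by (auto intro!: derivative_eq_intros sum.cong simp: mult_ac)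

lemma mgf'_deriv: "(mgf' n has_field_derivative mgf'' n s) (at s)"
  unfolding mgf'_def[abs_def] mgf''_def
  by (auto intro!: derivative_eq_intros sum.cong simp: mult_ac power2_eq_square)

definition R\<^sub>n' :: "nat \<Rightarrow> complex \<Rightarrow> complex" where
  "R\<^sub>n' n s = (mgf' n s - of_nat n * deriv K s * mgf n s) * exp (- of_nat n * K s)"

lemma Rn_deriv:
  assumes "s \<in> ball 0 \<delta>"
  shows "(R\<^sub>n n has_field_derivative R\<^sub>n' n s) (at s)"
  unfolding R\<^sub>n_def[abs_def] R\<^sub>n'_def
  by (rule derivative_eq_intros mgf_deriv K_deriv[OF assms] refl)+ (simp add: algebra_simps)

lemma Rn'_deriv:
  assumes "s \<in> ball 0 \<delta>"
  shows "(R\<^sub>n' n has_field_derivative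
     (mgf'' n s - of_nat n * deriv (deriv K) s * mgf n s - of_nat n * deriv K s * mgf' n s
       - of_nat n * deriv K s * (mgf' n s - of_nat n * deriv K s * mgf n s)) * exp (- of_nat n * K s)) (at s)"
  unfolding R\<^sub>n'_def[abs_def]
  by (rule derivative_eq_intros mgf_deriv mgf'_deriv K_deriv[OF assms] K_deriv2[OF assms] refl)+
     (simp add: algebra_simps)

lemma zero_in: "0 \<in> ball (0::complex) \<delta>"
  using \<delta> by simp

lemma mgf_0: "mgf n 0 = 1"
  using sum_p[of n] by (simp add: mgf_def flip: of_real_sum)

lemma mgf'_0: "mgf' n 0 = of_real (mean n)"
  by (simp add: mgf'_def mean_def)

lemma mgf''_0: "mgf'' n 0 = of_real (var n + mean n ^ 2)"
proof -
  have "var n = (\<Sum>k\<le>n. p n k * real k ^ 2) - 2 * mean n * (\<Sum>k\<le>n. p n k * real k) + mean n ^ 2 * (\<Sum>k\<le>n. p n k)"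
    unfolding var_def sum_distrib_left by (simp add: power2_eq_square algebra_simps sum.distrib sum_subtractf)
  then have "var n + mean n ^ 2 = (\<Sum>k\<le>n. p n k * real k ^ 2)"
    by (simp add: sum_p power2_eq_square flip: mean_def)
  then show ?thesis by (simp add: mgf''_def)
qed

lemma Rn_holo: "\<forall>\<^sub>F n in sequentially. R\<^sub>n n holomorphic_on ball 0 \<delta>"
  unfolding holomorphic_on_open[OF open_ball] using Rn_deriv by (intro always_eventually) blast

text \<open>\<open>mean n - n * m\<close> is the first derivative of \<open>R\<^sub>n n\<close> at
  0, and uniform limits of holomorphic functions may be differentiated.\<close>

lemma mean_diff_tendsto: "(\<lambda>n. of_real (mean n - real n * m)) \<longlonglongrightarrow> deriv R 0"
proof -
  have "(\<lambda>n. deriv (R\<^sub>n n) 0) \<longlonglongrightarrow> deriv R 0"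
    by (rule deriv_complex_uniform_limit[OF Rn_lim Rn_holo _ open_ball zero_in]) simp
  moreover have "deriv (R\<^sub>n n) 0 = of_real (mean n - real n * m)" for n
    using DERIV_imp_deriv[OF Rn_deriv[OF zero_in, of n]]
    by (simp add: R\<^sub>n'_def mgf_0 mgf'_0 K K1)
  ultimately show ?thesis by simp
qed

text \<open>The second derivative of \<open>R\<^sub>n n\<close> at 0 equals
  \<open>var n - n * v + (mean n - n * m)\<^sup>2\<close>; the squared first derivative is then
  subtracted.\<close>

lemma var_diff_tendsto: "(\<lambda>n. of_real (var n - real n * v)) \<longlonglongrightarrow> deriv (deriv R) 0 - (deriv R 0)\<^sup>2"
proof -
  have "(\<lambda>n. (deriv ^^ 2) (R\<^sub>n n) 0) \<longlonglongrightarrow> (deriv ^^ 2) R 0"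
    by (rule higher_deriv_complex_uniform_limit[OF Rn_lim Rn_holo _ open_ball zero_in]) simp
  moreover have "(deriv ^^ 2) (R\<^sub>n n) 0 = of_real (var n - real n * v + (mean n - real n * m)\<^sup>2)" for n
  proof -
    have "deriv (deriv (R\<^sub>n n)) 0 = deriv (R\<^sub>n' n) 0"
    proof (rule deriv_cong_ev)
      have "\<forall>\<^sub>F s in nhds 0. s \<in> ball 0 \<delta>"
        using zero_in by (intro eventually_nhds_in_open) auto
      then show "\<forall>\<^sub>F s in nhds 0. deriv (R\<^sub>n n) s = R\<^sub>n' n s"
        by eventually_elim (intro DERIV_imp_deriv Rn_deriv)
    qed simp
    also have "\<dots> = of_real (var n - real n * v + (mean n - real n * m)\<^sup>2)"
      using DERIV_imp_deriv[OF Rn'_deriv[OF zero_in, of n]]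
      by (simp add: mgf_0 mgf'_0 mgf''_0 K K1 K2 power2_eq_square algebra_simps)
    finally show ?thesis by (simp add: numeral_2_eq_2)
  qed
  ultimately have "(\<lambda>n. of_real (var n - real n * v + (mean n - real n * m)\<^sup>2)) \<longlonglongrightarrow> deriv (deriv R) 0"
    by (simp add: numeral_2_eq_2)
  from tendsto_diff[OF this tendsto_power[OF mean_diff_tendsto, of 2]]
  show ?thesis by simp
qed

text \<open>The convergent, hence bounded, error disappears on division by \<open>n\<close>.\<close>

lemma of_nat_quotient_tendsto:
  fixes f :: "nat \<Rightarrow> real"
  assumes "(\<lambda>n. complex_of_real (f n - real n * l)) \<longlonglongrightarrow> w"
  shows "(\<lambda>n. f n / real n) \<longlonglongrightarrow> l"
proof -
  have "(\<lambda>n. f n - real n * l) \<longlonglongrightarrow> Re w"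
    using tendsto_Re[OF assms] by simp
  moreover have "(\<lambda>n. 1 / real n) \<longlonglongrightarrow> 0"
    by real_asymp
  ultimately have "(\<lambda>n. (f n - real n * l) * (1 / real n) + l) \<longlonglongrightarrow> Re w * 0 + l"
    by (intro tendsto_intros)
  then have "(\<lambda>n. (f n - real n * l) * (1 / real n) + l) \<longlonglongrightarrow> l"
    by simp
  then show ?thesis
  proof (rule Lim_transform_eventually)
    show "\<forall>\<^sub>F n in sequentially. (f n - real n * l) * (1 / real n) + l = f n / real n"
      using eventually_gt_at_top[of 0] by eventually_elim (simp add: field_simps)
  qed
qed

lemma mean_tendsto: "(\<lambda>n. mean n / real n) \<longlonglongrightarrow> m"
  using mean_diff_tendsto by (rule of_nat_quotient_tendsto)

lemma var_tendsto: "(\<lambda>n. var n / real n) \<longlonglongrightarrow> v"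
  using var_diff_tendsto by (rule of_nat_quotient_tendsto)

lemma mean_asymp: "m \<noteq> 0 \<Longrightarrow> mean \<sim>[at_top] (\<lambda>n. m * real n)"
  using tendsto_divide[OF mean_tendsto tendsto_const[of m]]
  by (auto intro!: asymp_equivI' simp: mult.commute)

lemma var_asymp: "v \<noteq> 0 \<Longrightarrow> var \<sim>[at_top] (\<lambda>n. v * real n)"
  using tendsto_divide[OF var_tendsto tendsto_const[of v]]
  by (auto intro!: asymp_equivI' simp: mult.commute)

text \<open>At \<open>z = \<i> t / sqrt (var n)\<close> the characteristic function of the
  standardised row equals \<open>exp (n (K z - m z) - z (mean n - n m)) * R\<^sub>n n z\<close>.
  Since \<open>n z\<^sup>2\<close> tends to \<open>- t\<^sup>2 / v\<close>, the first part of the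
  exponent tends to \<open>- t\<^sup>2 / 2\<close>, the second to 0 and the last factor to
  1.\<close>

lemma char_tendsto:
  assumes v: "v > 0"
  shows "(\<lambda>n. \<Sum>k\<le>n. of_real (p n k) * exp (\<i> * of_real (t * ((real k - mean n) / sqrt (var n)))))
     \<longlonglongrightarrow> of_real (exp (- (t\<^sup>2) / 2))"
proof -
  define \<theta> where "\<theta> n = t / sqrt (var n)" for n
  define z where "z n = \<i> * of_real (\<theta> n)" for n
  have "\<forall>\<^sub>F n in sequentially. var n / real n > 0"
    using order_tendstoD(1)[OF var_tendsto v] .
  then have var_pos: "\<forall>\<^sub>F n in sequentially. var n > 0 \<and> n > 0"
    by eventually_elim (auto simp: zero_less_divide_iff)
  have n\<theta>: "(\<lambda>n. real n * \<theta> n ^ 2) \<longlonglongrightarrow> t\<^sup>2 / v"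
  proof (rule Lim_transform_eventually)
    show "(\<lambda>n. t\<^sup>2 / (var n / real n)) \<longlonglongrightarrow> t\<^sup>2 / v"
      using v by (intro tendsto_intros var_tendsto) auto
    show "\<forall>\<^sub>F n in sequentially. t\<^sup>2 / (var n / real n) = real n * \<theta> n ^ 2"
      using var_pos by eventually_elim (simp add: \<theta>_def power_divide)
  qed
  have "(\<lambda>n. real n * \<theta> n ^ 2 * (1 / real n)) \<longlonglongrightarrow> t\<^sup>2 / v * 0"
    by (intro tendsto_mult n\<theta>) real_asymp
  then have "(\<lambda>n. real n * \<theta> n ^ 2 * (1 / real n)) \<longlonglongrightarrow> 0"
    by simp
  then have "(\<lambda>n. \<theta> n ^ 2) \<longlonglongrightarrow> 0"
    by (rule Lim_transform_eventually[OF _ eventually_mono[OF eventually_gt_at_top[of 0]]]) simp_all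
  then have \<theta>0: "\<theta> \<longlonglongrightarrow> 0"
    by (simp add: tendsto_power_zero power_tendsto_0_iff)
  have z0: "z \<longlonglongrightarrow> 0"
    unfolding z_def using tendsto_mult[OF tendsto_const[of \<i>] tendsto_of_real[OF \<theta>0]] by simp
  have "(\<lambda>n. complex_of_real (- (real n * \<theta> n ^ 2))) \<longlonglongrightarrow> of_real (- (t\<^sup>2 / v))"
    by (intro tendsto_of_real tendsto_minus n\<theta>)
  then have "(\<lambda>n. of_nat n * z n ^ 2) \<longlonglongrightarrow> of_real (- (t\<^sup>2 / v))"
    by (simp add: z_def power_mult_distrib)
  from holomorphic_second_order[OF K(1) \<delta> K(2) z0 this]
  have 1: "(\<lambda>n. of_nat n * (K (z n) - of_real m * z n)) \<longlonglongrightarrow> of_real (- (t\<^sup>2) / 2)"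
    using v by (simp add: K1 K2)
  have 2: "(\<lambda>n. z n * of_real (mean n - real n * m)) \<longlonglongrightarrow> 0"
    using tendsto_mult[OF z0 mean_diff_tendsto] by simp
  have z_in: "\<forall>\<^sub>F n in sequentially. z n \<in> ball 0 \<delta>"
    using topological_tendstoD[OF z0 open_ball zero_in] .
  have "continuous_on (ball 0 \<delta>) R"
  proof (rule uniform_limit_theorem[OF _ Rn_lim])
    show "\<forall>\<^sub>F n in sequentially. continuous_on (ball 0 \<delta>) (R\<^sub>n n)"
      using Rn_holo by eventually_elim (rule holomorphic_on_imp_continuous_on)
  qed simp
  then have "isCont R 0"
    using zero_in by (simp add: continuous_on_eq_continuous_at)
  then have Rz: "(\<lambda>n. R (z n)) \<longlonglongrightarrow> R 0"
    using z0 by (rule isCont_tendsto_compose)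
  have "(\<lambda>n. R\<^sub>n n 0) \<longlonglongrightarrow> R 0"
    using tendsto_uniform_limitI[OF Rn_lim zero_in] .
  then have R0: "R 0 = 1"
    by (simp add: R\<^sub>n_def mgf_0 K LIMSEQ_const_iff)
  \<comment> \<open>Uniform convergence allows the argument \<open>z n\<close> to move with
    \<open>n\<close>.\<close>
  have "(\<lambda>n. R\<^sub>n n (z n) - R (z n)) \<longlonglongrightarrow> 0"
  proof (rule LIMSEQ_I)
    fix e :: real assume "e > 0"
    from uniform_limitD[OF Rn_lim this] z_in
    have "\<forall>\<^sub>F n in sequentially. norm (R\<^sub>n n (z n) - R (z n) - 0) < e"
      by eventually_elim (auto simp: dist_norm)
    then show "\<exists>no. \<forall>n\<ge>no. norm (R\<^sub>n n (z n) - R (z n) - 0) < e"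
      by (simp add: eventually_sequentially)
  qed
  from tendsto_add[OF this Rz] have 3: "(\<lambda>n. R\<^sub>n n (z n)) \<longlonglongrightarrow> 1"
    by (simp add: R0)
  have "(\<lambda>n. exp (of_nat n * (K (z n) - of_real m * z n) - z n * of_real (mean n - real n * m)) * R\<^sub>n n (z n))
     \<longlonglongrightarrow> exp (of_real (- (t\<^sup>2) / 2) - 0) * 1"
    by (intro tendsto_intros 1 2 3)
  moreover have "exp (of_nat n * (K (z n) - of_real m * z n) - z n * of_real (mean n - real n * m)) * R\<^sub>n n (z n)
    = (\<Sum>k\<le>n. of_real (p n k) * exp (\<i> * of_real (t * ((real k - mean n) / sqrt (var n)))))" for n
  proof -
    have "exp (of_nat n * (K (z n) - of_real m * z n) - z n * of_real (mean n - real n * m)) * R\<^sub>n n (z n)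
       = exp (of_nat n * (K (z n) - of_real m * z n) - z n * of_real (mean n - real n * m) + (- of_nat n * K (z n))) * mgf n (z n)"
      unfolding R\<^sub>n_def exp_add by (simp add: mult_ac)
    also have "of_nat n * (K (z n) - of_real m * z n) - z n * of_real (mean n - real n * m) + (- of_nat n * K (z n))
       = - (z n * of_real (mean n))"
      by (simp add: algebra_simps)
    also have "exp (- (z n * of_real (mean n))) * mgf n (z n)
       = (\<Sum>k\<le>n. of_real (p n k) * (exp (- (z n * of_real (mean n))) * exp (of_nat k * z n)))"
      unfolding mgf_def sum_distrib_left by (simp add: mult_ac)
    also have "\<dots> = (\<Sum>k\<le>n. of_real (p n k) * exp (\<i> * of_real (t * ((real k - mean n) / sqrt (var n)))))"
      unfolding exp_add[symmetric] z_def \<theta>_def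
      by (intro sum.cong refl arg_cong[of _ _ "\<lambda>x. _ * exp x"]) (simp add: algebra_simps diff_divide_distrib)
    finally show ?thesis .
  qed
  moreover have "exp (of_real (- (t\<^sup>2) / 2) - 0) * 1 = complex_of_real (exp (- (t\<^sup>2) / 2))"
    unfolding diff_zero mult_1_right exp_of_real ..
  ultimately show ?thesis
    by (simp only:)
qed

end

section \<open>The function \<open>L\<close>\<close>

lemma lin_fps_radius:
  assumes "a \<ge> 0" "d \<ge> 0" "R \<ge> 0" "a * R < 1"
  shows "ereal R \<le> fps_conv_radius (lin_fps a d)"
proof -
  have "summable (\<lambda>n. complex_of_real (lin_coeff a d n * R ^ n))"
    unfolding summable_complex_of_real by (rule summable_lin_coeff) fact+
  then show ?thesis
    using conv_radius_geI[of "fps_nth (lin_fps a d)" "of_real R"] assms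
    by (simp add: fps_conv_radius_def)
qed

lemma L_fps_radius:
  assumes "a \<ge> 0" "b \<ge> 0" "R \<ge> 0" "a * R < 1"
  shows "ereal R \<le> fps_conv_radius (L_fps a b)"
proof -
  have "summable (\<lambda>n. L_coeff a b (Suc n) * R ^ Suc n)"
  proof (rule summable_comparison_test')
    show "summable (\<lambda>n. R * (lin_coeff a (a + b) n * R ^ n))"
      using assms by (intro summable_mult summable_lin_coeff) auto
    show "norm (L_coeff a b (Suc n) * R ^ Suc n) \<le> R * (lin_coeff a (a + b) n * R ^ n)" for n
    proof -
      have "lin_coeff a (a + b) n / real (Suc n) \<le> lin_coeff a (a + b) n / 1"
        using assms lin_coeff_nonneg[of a "a + b" n] by (intro divide_left_mono) auto
      then have "lin_coeff a (a + b) n / real (Suc n) * R ^ Suc n \<le> lin_coeff a (a + b) n * R ^ Suc n"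
        using assms by (intro mult_right_mono) auto
      then show ?thesis
        using assms lin_coeff_nonneg[of a "a + b" n]
        by (simp add: L_coeff_def abs_mult mult_ac del: of_nat_Suc)
    qed
  qed
  then have "summable (\<lambda>n. complex_of_real (L_coeff a b n * R ^ n))"
    unfolding summable_complex_of_real by (subst (asm) summable_Suc_iff)
  then show ?thesis
    using conv_radius_geI[of "fps_nth (L_fps a b)" "of_real R"] assms
    by (simp add: fps_conv_radius_def)
qed

lemma L_coeff_nonneg: "a \<ge> 0 \<Longrightarrow> b \<ge> 0 \<Longrightarrow> L_coeff a b n \<ge> 0"
  by (simp add: L_coeff_def lin_coeff_nonneg)

definition L_fun :: "real \<Rightarrow> real \<Rightarrow> complex \<Rightarrow> complex" where
  "L_fun a b = eval_fps (L_fps a b)"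

locale L_params =
  fixes a b :: real
  assumes a: "a \<ge> 0" and b: "b \<ge> 0"
begin

text \<open>The disc of radius \<open>1 / a\<close>, or the whole plane for \<open>a = 0\<close>;
  the form without division treats both at once.\<close>

abbreviation "D \<equiv> {z :: complex. a * norm z < 1}"

lemma D_radius:
  assumes "z \<in> D" "d \<ge> 0"
  shows "ereal (norm z) < fps_conv_radius (lin_fps a d)" "ereal (norm z) < fps_conv_radius (L_fps a b)"
proof -
  \<comment> \<open>A point \<open>x\<close> beyond \<open>norm z\<close> that still satisfies
    \<open>a * x < 1\<close>; the denominator \<open>2 * (a + 1)\<close> avoids dividing by
    \<open>a\<close>, which may be 0.\<close>
  define y where "y = (1 - a * norm z) / (2 * (a + 1))"
  define x where "x = norm z + y"
  have *: "0 < y" using assms a by (auto simp: y_def)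
  have "a * y \<le> (a + 1) * y"
    using * by (intro mult_right_mono) auto
  also have "\<dots> = (1 - a * norm z) / 2"
    using a nonzero_mult_divide_mult_cancel_left[of "a + 1" "1 - a * norm z" 2] by (simp add: y_def mult.commute)
  finally have "a * norm z + a * y < 1" using assms by simp
  then have "a * x < 1" by (simp add: x_def ring_distribs)
  moreover have x: "norm z < x" using * by (simp add: x_def)
  moreover have "x \<ge> 0" using x norm_ge_zero[of z] by linarith
  ultimately have "ereal x \<le> fps_conv_radius (lin_fps a d)" "ereal x \<le> fps_conv_radius (L_fps a b)"
    using a b assms by (auto intro: lin_fps_radius L_fps_radius)
  with x show "ereal (norm z) < fps_conv_radius (lin_fps a d)" "ereal (norm z) < fps_conv_radius (L_fps a b)"
    by (meson ereal_less_le less_ereal.simps(1) order_less_le_trans)+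
qed

lemma ball_sub_D: "a * R < 1 \<Longrightarrow> ball 0 R \<subseteq> D"
proof
  fix z :: complex assume "a * R < 1" "z \<in> ball 0 R"
  moreover from this have "a * norm z \<le> a * R" using a by (intro mult_left_mono) auto
  ultimately show "z \<in> D" by simp
qed

lemma lin_holo: "d \<ge> 0 \<Longrightarrow> eval_fps (lin_fps a d) holomorphic_on D"
  by (intro holomorphic_intros) (use D_radius in auto)

lemma lin_expansion: "d \<ge> 0 \<Longrightarrow> eval_fps (lin_fps a d) has_fps_expansion lin_fps a d"
  using D_radius(1)[of 0 d] by (intro eval_fps_has_fps_expansion) (simp add: zero_ereal_def)

lemma L_holo: "L_fun a b holomorphic_on D"
  unfolding L_fun_def by (intro holomorphic_intros) (use D_radius(2)[of _ 0] in auto)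

lemma L_expansion: "L_fun a b has_fps_expansion L_fps a b"
  unfolding L_fun_def using D_radius(2)[of 0 0] by (intro eval_fps_has_fps_expansion) (simp add: zero_ereal_def)

lemma L_0: "L_fun a b 0 = 0"
  by (simp add: L_fun_def eval_fps_at_0)

definition L' :: "complex \<Rightarrow> complex" where "L' = eval_fps (fps_deriv (L_fps a b))"

lemma L_deriv: "z \<in> D \<Longrightarrow> (L_fun a b has_field_derivative L' z) (at z)"
  unfolding L_fun_def L'_def using D_radius(2)[of z 0] by (intro has_field_derivative_eval_fps) auto

lemma L_ODE:
  assumes z: "z \<in> D"
  shows "(1 - of_real a * z) * L' z = 1 + of_real b * L_fun a b z"
proof -
  have r: "ereal (norm z) < fps_conv_radius (fps_deriv (L_fps a b))"
    "ereal (norm z) < fps_conv_radius (L_fps a b)"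
    using D_radius[OF z, of "a + b"] a b by (auto simp: fps_deriv_L)
  have r1: "ereal (norm z) < fps_conv_radius (fps_const (complex_of_real a) * fps_X)"
    using fps_conv_radius_mult[of "fps_const (complex_of_real a)" "fps_X"] by simp
  have r2: "ereal (norm z) < fps_conv_radius (1 - fps_const (complex_of_real a) * fps_X)"
    using fps_conv_radius_diff[of 1 "fps_const (complex_of_real a) * fps_X"] r1
    by (simp add: min_def split: if_splits)
  have r3: "ereal (norm z) < fps_conv_radius (fps_const (complex_of_real b) * L_fps a b)"
    using fps_conv_radius_mult[of "fps_const (complex_of_real b)" "L_fps a b"] r(2) by simp
  have "(1 - of_real a * z) * L' z = eval_fps ((1 - fps_const (of_real a) * fps_X) * fps_deriv (L_fps a b)) z"
    using r r1 r2 by (simp add: eval_fps_mult eval_fps_diff L'_def)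
  also have "\<dots> = 1 + of_real b * L_fun a b z"
    unfolding L_fps_ODE using r r3 by (simp add: eval_fps_mult eval_fps_add L_fun_def)
  finally show ?thesis .
qed

lemma D_convex: "convex D"
proof (cases "a = 0")
  case False
  then have "D = ball 0 (1 / a)" using a by (auto simp: field_simps)
  then show ?thesis by simp
qed simp

text \<open>\<open>1 - a z\<close> has positive real part on \<open>D\<close>, so its principal
  logarithm and powers are holomorphic there.\<close>

lemma D_nonpos: "z \<in> D \<Longrightarrow> 1 - of_real a * z \<notin> \<real>\<^sub>\<le>\<^sub>0"
proof
  assume z: "z \<in> D" "1 - of_real a * z \<in> \<real>\<^sub>\<le>\<^sub>0"
  then have "Re (1 - of_real a * z) \<le> 0" by (simp add: complex_nonpos_Reals_iff)
  moreover have "a * Re z \<le> a * norm z" using a by (intro mult_left_mono complex_Re_le_cmod)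
  ultimately show False using z by simp
qed

lemma L_sums: "x \<in> D \<Longrightarrow> (\<lambda>n. of_real (L_coeff a b n) * x ^ n) sums L_fun a b x"
  using sums_eval_fps[OF D_radius(2)[of x 0]] by (simp add: L_fun_def)

text \<open>All coefficients are nonnegative, and beyond the linear term \<open>x\<close> the
  quadratic coefficient \<open>(a + b) / 2\<close> is positive, which gives strictness. This makes
  the variance constant positive.\<close>

lemma L_real_ge:
  assumes x: "0 < x" "a * x < 1" and ab: "a + b > 0"
  shows "Re (L_fun a b (of_real x)) > x"
proof -
  have "(\<lambda>n. of_real (L_coeff a b n) * of_real x ^ n) sums L_fun a b (of_real x)"
    using x by (intro L_sums) auto
  from sums_Re[OF this] have s: "(\<lambda>n. L_coeff a b n * x ^ n) sums Re (L_fun a b (of_real x))"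
    by (simp flip: of_real_power of_real_mult)
  have "L_coeff a b 2 = (a + b) / 2"
    by (simp add: L_coeff_def lin_coeff_def)
  moreover have "(\<Sum>n<3. L_coeff a b n * x ^ n) = x + L_coeff a b 2 * x ^ 2"
    by (simp add: eval_nat_numeral)
  ultimately have "x < (\<Sum>n<3. L_coeff a b n * x ^ n)"
    using x ab by simp
  also have "\<dots> \<le> (\<Sum>n. L_coeff a b n * x ^ n)"
    using s a b x by (intro sum_le_suminf) (auto simp: sums_iff L_coeff_nonneg)
  finally show ?thesis using s by (simp add: sums_iff)
qed

text \<open>As the coefficients are nonnegative and \<open>Re (w ^ n) \<le> x ^ n\<close>, equality
  of the sums forces equality of all terms. The linear coefficient is 1, so \<open>Re w = x\<close>,
  and \<open>norm w \<le> x\<close> leaves no room for an imaginary part.\<close>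

lemma L_unique:
  assumes x: "0 < x" "a * x < 1" and w: "norm w \<le> x" "L_fun a b w = L_fun a b (of_real x)"
  shows "w = of_real x"
proof -
  have "a * norm w \<le> a * x" using w a by (intro mult_left_mono)
  then have "(\<lambda>n. of_real (L_coeff a b n) * w ^ n) sums L_fun a b w"
    using x by (intro L_sums) auto
  moreover have "(\<lambda>n. of_real (L_coeff a b n) * of_real x ^ n) sums L_fun a b (of_real x)"
    using x by (intro L_sums) auto
  ultimately have "(\<lambda>n. of_real (L_coeff a b n) * of_real x ^ n - of_real (L_coeff a b n) * w ^ n) sums 0"
    using sums_diff w(2) by fastforce
  from sums_Re[OF this] have "(\<lambda>n. L_coeff a b n * (x ^ n - Re (w ^ n))) sums 0"
    by (simp add: algebra_simps flip: of_real_power)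
  moreover have "0 \<le> L_coeff a b n * (x ^ n - Re (w ^ n))" for n
  proof -
    have "Re (w ^ n) \<le> norm w ^ n" using complex_Re_le_cmod[of "w ^ n"] by (simp add: norm_power)
    also have "\<dots> \<le> x ^ n" using w by (intro power_mono) auto
    finally show ?thesis using L_coeff_nonneg[OF a b, of n] by simp
  qed
  ultimately have "\<forall>n. L_coeff a b n * (x ^ n - Re (w ^ n)) = 0"
    using suminf_eq_zero_iff[of "\<lambda>n. L_coeff a b n * (x ^ n - Re (w ^ n))"] unfolding sums_iff by blast
  then have "L_coeff a b 1 * (x ^ 1 - Re (w ^ 1)) = 0"
    by blast
  then have Re: "Re w = x" by simp
  then have "norm w = Re w" using w complex_Re_le_cmod[of w] by simp
  then have "Im w = 0" using cmod_power2[of w] by simp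
  with Re show ?thesis by (simp add: complex_eq_iff)
qed

text \<open>The constant coefficient is 1 and the others are nonnegative.\<close>

lemma lin_eval_nonzero:
  assumes x: "0 \<le> x" "a * x < 1" and d: "d \<ge> 0"
  shows "eval_fps (lin_fps a d) (of_real x) \<noteq> 0"
proof -
  have "(\<lambda>n. of_real (lin_coeff a d n) * of_real x ^ n) sums eval_fps (lin_fps a d) (of_real x)"
    using sums_eval_fps[OF D_radius(1)[of "of_real x" d]] x d by simp
  from sums_Re[OF this] have s: "(\<lambda>n. lin_coeff a d n * x ^ n) sums Re (eval_fps (lin_fps a d) (of_real x))"
    by (simp flip: of_real_power of_real_mult)
  have "0 < (\<Sum>n<1. lin_coeff a d n * x ^ n)" by simp
  also have "\<dots> \<le> (\<Sum>n. lin_coeff a d n * x ^ n)"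
    using s a d x by (intro sum_le_suminf) (auto simp: sums_iff lin_coeff_nonneg)
  finally show ?thesis using s by (auto simp: sums_iff)
qed

section \<open>Closed forms of \<open>L\<close> on the real axis\<close>

text \<open>By the equation for \<open>L\<close>, the function
  \<open>(1 + b L) (1 - a z) powr (b / a)\<close> has derivative 0 on the convex set
  \<open>D\<close>, so it keeps its value 1 at 0.\<close>

lemma L_eval_powr:
  assumes ab: "a > 0" "b > 0" and x: "0 \<le> x" "a * x < 1"
  shows "L_fun a b (of_real x) = of_real (((1 - a * x) powr (- b / a) - 1) / b)"
proof -
  define H where "H z = (1 + of_real b * L_fun a b z) * (1 - of_real a * z) powr of_real (b / a)" for z
  have "(H has_field_derivative 0) (at z within D)" if z: "z \<in> D" for z
  proof -
    have nz: "1 - of_real a * z \<noteq> 0" using D_nonpos[OF z] by auto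
    have "(H has_field_derivative
        (of_real b * L' z) * (1 - of_real a * z) powr of_real (b / a) +
        (1 + of_real b * L_fun a b z) * (of_real (b / a) * (1 - of_real a * z) powr (of_real (b / a) - 1) * (- of_real a))) (at z)"
      unfolding H_def[abs_def]
      by (rule derivative_eq_intros L_deriv[OF z] has_field_derivative_powr_right refl D_nonpos[OF z])+
         (use D_nonpos[OF z] in \<open>auto simp: algebra_simps\<close>)
    moreover have "(of_real b * L' z) * (1 - of_real a * z) powr of_real (b / a) +
        (1 + of_real b * L_fun a b z) * (of_real (b / a) * (1 - of_real a * z) powr (of_real (b / a) - 1) * (- of_real a)) = 0"
      unfolding L_ODE[OF z, symmetric] powr_diff using nz ab by simp
    ultimately show ?thesis using has_field_derivative_at_within by metis
  qed
  moreover have xD: "of_real x \<in> D" and "0 \<in> D" using x by auto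
  ultimately have "H (of_real x) = H 0"
    using has_field_derivative_zero_constant[OF D_convex, of H] by metis
  then have "(1 + of_real b * L_fun a b (of_real x)) * of_real ((1 - a * x) powr (b / a)) = 1"
    using x by (simp add: H_def L_0 powr_of_real[symmetric])
  moreover have "(1 - a * x) powr (b / a) \<noteq> 0" using x by simp
  ultimately have "1 + of_real b * L_fun a b (of_real x) = of_real (1 / (1 - a * x) powr (b / a))"
    by (simp add: field_simps)
  also have "1 / (1 - a * x) powr (b / a) = (1 - a * x) powr (- b / a)"
    by (simp add: powr_minus divide_inverse)
  finally have "of_real b * L_fun a b (of_real x) = of_real ((1 - a * x) powr (- b / a) - 1)"
    by (simp add: algebra_simps)
  then show ?thesis using ab by (simp add: field_simps)
qed

text \<open>The same argument with the integrating factor \<open>exp (- b z)\<close>.\<close>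

lemma L_eval_exp:
  assumes ab: "a = 0" "b > 0"
  shows "L_fun a b (of_real x) = of_real ((exp (b * x) - 1) / b)"
proof -
  define H where "H z = (1 + of_real b * L_fun a b z) * exp (- of_real b * z)" for z
  have "(H has_field_derivative 0) (at z within UNIV)" for z
  proof -
    have z: "z \<in> D" using ab by simp
    have "(H has_field_derivative
        (of_real b * L' z) * exp (- of_real b * z) +
        (1 + of_real b * L_fun a b z) * (- of_real b * exp (- of_real b * z))) (at z)"
      unfolding H_def[abs_def]
      by (rule derivative_eq_intros L_deriv[OF z] refl)+ (auto simp: algebra_simps)
    moreover have "(of_real b * L' z) * exp (- of_real b * z) +
        (1 + of_real b * L_fun a b z) * (- of_real b * exp (- of_real b * z)) = 0"
      unfolding L_ODE[OF z, symmetric] using ab by simp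
    ultimately show ?thesis by metis
  qed
  then have "H (of_real x) = H 0"
    using has_field_derivative_zero_constant[OF convex_UNIV, of H] by (metis UNIV_I)
  then have "(1 + of_real b * L_fun a b (of_real x)) * of_real (exp (- b * x)) = 1"
    by (simp add: H_def L_0 exp_of_real[symmetric])
  then have "1 + of_real b * L_fun a b (of_real x) = of_real (exp (b * x))"
    by (simp add: exp_minus field_simps)
  then have "of_real b * L_fun a b (of_real x) = of_real (exp (b * x) - 1)"
    by (simp add: algebra_simps)
  then show ?thesis using ab by (simp add: field_simps)
qed

text \<open>For \<open>b = 0\<close> the equation reads \<open>L' = 1 / (1 - a z)\<close>, so
  \<open>a L + Ln (1 - a z)\<close> is constant.\<close>

lemma L_eval_ln:
  assumes ab: "a > 0" "b = 0" and x: "0 \<le> x" "a * x < 1"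
  shows "L_fun a b (of_real x) = of_real (- ln (1 - a * x) / a)"
proof -
  define H where "H z = of_real a * L_fun a b z + Ln (1 - of_real a * z)" for z
  have "(H has_field_derivative 0) (at z within D)" if z: "z \<in> D" for z
  proof -
    have nz: "1 - of_real a * z \<noteq> 0" using D_nonpos[OF z] by auto
    have "(H has_field_derivative of_real a * L' z - of_real a / (1 - of_real a * z)) (at z)"
      unfolding H_def[abs_def]
      by (rule derivative_eq_intros L_deriv[OF z] refl D_nonpos[OF z])+ (use nz in \<open>auto simp: field_simps\<close>)
    moreover have "L' z = 1 / (1 - of_real a * z)"
      using L_ODE[OF z] ab nz by (simp add: field_simps)
    ultimately show ?thesis using has_field_derivative_at_within by simp
  qed
  moreover have xD: "of_real x \<in> D" and "0 \<in> D" using x by auto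
  ultimately have "H (of_real x) = H 0"
    using has_field_derivative_zero_constant[OF D_convex, of H] by metis
  moreover have "Ln (1 - of_real a * of_real x) = of_real (ln (1 - a * x))"
    using x Ln_of_real[of "1 - a * x"] by simp
  ultimately have "of_real a * L_fun a b (of_real x) = of_real (- ln (1 - a * x))"
    by (simp add: H_def L_0 eq_neg_iff_add_eq_0)
  then show ?thesis using ab by (simp add: field_simps)
qed

end

section \<open>The central limit theorem\<close>

text \<open>\<open>\<rho>\<close> is the dominant singularity of the generating function at
  \<open>x = 1\<close>. Characterising it by \<open>L \<rho> = 1 / b'\<close> lets one argument
  serve all three regimes; \<open>a + b > 0\<close> makes \<open>L\<close> nonlinear, which gives
  \<open>v > 0\<close>.\<close>

locale gkp_params = L_params a b for a b :: real +
  fixes c b' c' \<rho> :: real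
  assumes c: "c \<ge> 0" and b': "b' > 0" and c': "c' \<ge> 0" and ab: "a + b > 0"
    and \<rho>: "\<rho> > 0" "a * \<rho> < 1" and L\<rho>: "L_fun a b (of_real \<rho>) = of_real (1 / b')"
begin

definition total :: "nat \<Rightarrow> real" where "total n = (\<Sum>k\<le>n. gkp a b c 0 b' c' n k)"

definition prob :: "nat \<Rightarrow> nat \<Rightarrow> real" where "prob n k = gkp a b c 0 b' c' n k / total n"

text \<open>\<open>m\<close> and \<open>v\<close> are the future \<open>K'(0)\<close> and
  \<open>K''(0)\<close>: put \<open>u = \<rho>\<close> and \<open>s = 0\<close> in
  \<open>K'(s) = (1 / u - a) / (b' exp s + b)\<close> and in its derivative, using
  \<open>u' = - u K'\<close>.\<close>

definition m :: real where "m = (1 - a * \<rho>) / (\<rho> * (b' + b))"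

definition v :: real where "v = m * (1 - b' * \<rho>) / (\<rho> * (b' + b))"

lemma total_pos: "total n > 0"
proof -
  have "0 < gkp a b c 0 b' c' n n" using b' c' by (intro gkp_diag_pos)
  also have "\<dots> \<le> total n"
    unfolding total_def using a b c b' c' by (intro member_le_sum gkp_nonneg) auto
  finally show ?thesis .
qed

lemma sum_prob: "(\<Sum>k\<le>n. prob n k) = 1"
  using total_pos[of n] by (simp add: prob_def total_def flip: sum_divide_distrib)

lemma m_pos: "m > 0"
  using \<rho> b b' by (auto simp: m_def intro!: divide_pos_pos mult_pos_pos)

text \<open>\<open>L \<rho> > \<rho>\<close> means \<open>b' * \<rho> < 1\<close>.\<close>

lemma v_pos: "v > 0"
proof -
  have "\<rho> < 1 / b'" using L_real_ge[OF \<rho> ab] L\<rho> by simp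
  then have "b' * \<rho> < 1" using b' by (simp add: field_simps)
  then show ?thesis
    using m_pos \<rho> b b' by (auto simp: v_def intro!: divide_pos_pos mult_pos_pos)
qed

definition r :: real where "r = 1 + c' / b'"

text \<open>The row polynomial at \<open>x = 1 / (b' L(u))\<close>, scaled by
  \<open>u ^ n / (n! c\<^sub>n)\<close>. For this \<open>x\<close> the product \<open>b' x\<close>
  is \<open>1 / L(u)\<close>, the form treated by
  \<open>algebraic_singularity_uniform_limit\<close>.\<close>

definition q :: "nat \<Rightarrow> complex \<Rightarrow> complex" where
  "q n u = fps_nth (lin_fps a (a + c) *
     (fps_binomial (- of_real r) oo (fps_const (- (1 / L_fun a b u)) * L_fps a b))) n
     * u ^ n / of_real (neg_binom_coeff r n)"

lemma q_eq:
  assumes "exp s = 1 / (of_real b' * L_fun a b u)"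
  shows "q n u = (\<Sum>k\<le>n. of_real (gkp a b c 0 b' c' n k) * exp (of_nat k * s)) / fact n
     * u ^ n / of_real (neg_binom_coeff r n)"
proof -
  have "of_real b' * exp s = 1 / L_fun a b u"
    using b' unfolding assms by simp
  then show ?thesis
    using sum_gkp_power[of b' a b c c' n "exp s"] b'
    by (simp add: q_def r_def exp_of_nat_mult)
qed

text \<open>The point \<open>u = \<rho>\<close> corresponds to \<open>x = 1\<close>, where the row
  polynomial is the row sum; this value is the normalising divisor.\<close>

lemma q_rho: "q n (of_real \<rho>) = of_real (total n * \<rho> ^ n / (fact n * neg_binom_coeff r n))"
proof -
  have "exp 0 = 1 / (of_real b' * L_fun a b (of_real \<rho>))"
    using b' by (simp add: L\<rho>)
  from q_eq[OF this, of n] show ?thesis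
    by (simp add: total_def)
qed

lemma q_rho_nonzero: "q n (of_real \<rho>) \<noteq> 0"
proof -
  have "r > 0" using b' c' by (simp add: r_def add_pos_nonneg)
  then show ?thesis
    using total_pos[of n] \<rho> neg_binom_coeff_pos[of r n] unfolding q_rho of_real_eq_0_iff by simp
qed

text \<open>Near \<open>\<rho>\<close>, \<open>s = - Ln (b' L(u))\<close> is inverted to
  \<open>u = g s\<close>. Then \<open>q n (g s) / q n \<rho>\<close> is the moment generating
  function times \<open>(g s / \<rho>) ^ n\<close>, which identifies
  \<open>K s = - Ln (g s / \<rho>)\<close> and the limit \<open>Q (g s) / Q \<rho>\<close>.\<close>

theorem obtain_quasi_powers:
  obtains K R \<delta> where "quasi_powers prob K R \<delta> m v"
proof -
  let ?L = "L_fun a b" and ?p = "complex_of_real \<rho>"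
  have pD: "?p \<in> D" using \<rho> by simp
  \<comment> \<open>A radius between \<open>\<rho>\<close> and \<open>1 / a\<close>, or any radius
    beyond \<open>\<rho>\<close> if \<open>a = 0\<close>.\<close>
  obtain R0 where R0: "\<rho> < R0" "a * R0 < 1"
  proof (cases "a = 0")
    case True
    then show ?thesis using that[of "\<rho> + 1"] by simp
  next
    case False
    then show ?thesis using that[of "(\<rho> + 1 / a) / 2"] a \<rho> by (simp add: field_simps)
  qed
  have Lp: "?L ?p \<noteq> 0" using b' by (simp add: L\<rho>)
  \<comment> \<open>The equation for \<open>L\<close> at \<open>\<rho>\<close> gives
    \<open>(1 - a \<rho>) L'(\<rho>) = 1 + b / b' > 0\<close>.\<close>
  have L'p: "L' ?p \<noteq> 0"
  proof
    assume "L' ?p = 0"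
    with L_ODE[OF pD] have "complex_of_real (1 + b / b') = 0" by (simp add: L\<rho>)
    then have "1 + b / b' = 0" unfolding of_real_eq_0_iff .
    moreover have "1 + b / b' > 0" using b b' by (simp add: add_pos_nonneg)
    ultimately show False by linarith
  qed
  obtain \<delta>1 Q where \<delta>1: "\<delta>1 > 0" "ball ?p \<delta>1 \<subseteq> ball 0 R0"
    "\<And>u. u \<in> ball ?p \<delta>1 \<Longrightarrow> u \<noteq> 0 \<and> ?L u \<noteq> 0" and Qp: "Q ?p \<noteq> 0"
    and lim: "uniform_limit (ball ?p \<delta>1) q Q sequentially"
  proof (rule algebraic_singularity_uniform_limit[of ?L R0 "L_fps a b" "eval_fps (lin_fps a (a + c))" "lin_fps a (a + c)" ?p r])
    show "?L holomorphic_on ball 0 R0"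
      using L_holo ball_sub_D[OF R0(2)] by (rule holomorphic_on_subset)
    show "eval_fps (lin_fps a (a + c)) holomorphic_on ball 0 R0"
      using lin_holo[of "a + c"] a c ball_sub_D[OF R0(2)] by (auto intro: holomorphic_on_subset)
    show "eval_fps (lin_fps a (a + c)) ?p \<noteq> 0"
      using \<rho> a c by (intro lin_eval_nonzero) auto
    show "w = ?p" if "norm w \<le> norm ?p" "?L w = ?L ?p" for w
      using L_unique[OF \<rho>] that \<rho> by simp
    show "deriv ?L ?p \<noteq> 0"
      using DERIV_imp_deriv[OF L_deriv[OF pD]] L'p by simp
  qed (use L_expansion lin_expansion[of "a + c"] a c \<rho> R0 b' c' in \<open>auto simp: r_def q_def[abs_def]\<close>)
  \<comment> \<open>A radius of at most \<open>\<rho>\<close> puts \<open>u / \<rho>\<close> in the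
    unit disc about 1, where \<open>Ln\<close> is holomorphic; \<open>S\<close> demands the same of
    \<open>b' L(u)\<close>.\<close>
  define B where "B = ball ?p (min \<delta>1 \<rho>)"
  have BD: "B \<subseteq> D" using \<delta>1(2) ball_sub_D[OF R0(2)] by (auto simp: B_def)
  define S where "S = B \<inter> (\<lambda>u. of_real b' * ?L u) -` ball 1 1"
  have S_open: "open S"
    unfolding S_def using BD
    by (intro continuous_open_preimage continuous_intros holomorphic_on_imp_continuous_on[OF holomorphic_on_subset[OF L_holo]])
       (auto simp: B_def)
  have pS: "?p \<in> S" using \<delta>1 \<rho> b' by (simp add: S_def B_def L\<rho>)
  define f where "f u = - Ln (of_real b' * ?L u)" for u
  have pos: "z \<notin> \<real>\<^sub>\<le>\<^sub>0" if "z \<in> ball 1 1" for z :: complex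
  proof
    assume "z \<in> \<real>\<^sub>\<le>\<^sub>0"
    then have "Re z \<le> 0" by (simp add: complex_nonpos_Reals_iff)
    moreover have "\<bar>Re (1 - z)\<bar> \<le> norm (1 - z)" by (rule abs_Re_le_cmod)
    ultimately show False using that by (simp add: dist_norm)
  qed
  have SD: "u \<in> D" "u \<noteq> 0" "?L u \<noteq> 0" "of_real b' * ?L u \<notin> \<real>\<^sub>\<le>\<^sub>0" if "u \<in> S" for u
  proof -
    have "u \<in> B" "of_real b' * ?L u \<in> ball 1 1" using that by (auto simp: S_def)
    with BD pos \<delta>1(3)[of u] show "u \<in> D" "u \<noteq> 0" "?L u \<noteq> 0" "of_real b' * ?L u \<notin> \<real>\<^sub>\<le>\<^sub>0"
      unfolding B_def by auto
  qed
  have f_deriv: "(f has_field_derivative - (L' u / ?L u)) (at u)" if "u \<in> S" for u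
    unfolding f_def[abs_def]
    by (rule derivative_eq_intros L_deriv SD[OF that] refl)+ (use SD[OF that] b' in \<open>simp_all add: field_simps\<close>)
  have f_holo: "f holomorphic_on S"
    using f_deriv by (auto simp: holomorphic_on_open S_open)
  have fp: "f ?p = 0" using b' by (simp add: f_def L\<rho>)
  have "deriv f ?p \<noteq> 0" using DERIV_imp_deriv[OF f_deriv[OF pS]] L'p Lp by simp
  then obtain r0 where r0: "r0 > 0" "ball ?p r0 \<subseteq> S" "open (f ` ball ?p r0)" "inj_on f (ball ?p r0)"
    using has_complex_derivative_locally_invertible[OF f_holo pS S_open] by blast
  define U where "U = f ` ball ?p r0"
  have U: "open U" "0 \<in> U"
    using r0 fp by (auto simp: U_def intro!: image_eqI[of _ _ ?p])
  obtain g where g: "g holomorphic_on U" "\<And>z. z \<in> ball ?p r0 \<Longrightarrow> deriv f z * deriv g (f z) = 1"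
    "\<And>z. z \<in> ball ?p r0 \<Longrightarrow> g (f z) = z"
    using holomorphic_has_inverse[OF holomorphic_on_subset[OF f_holo r0(2)] open_ball r0(4)]
    unfolding U_def by blast
  have g0: "g 0 = ?p" using g(3)[of ?p] r0 fp by simp
  have gS: "g s \<in> S" if "s \<in> U" for s
    using that g(3) r0(2) by (auto simp: U_def)
  have exp_g: "exp s = 1 / (of_real b' * ?L (g s))" if s: "s \<in> U" for s
  proof -
    obtain u where u: "u \<in> ball ?p r0" "s = f u" using s by (auto simp: U_def)
    have "of_real b' * ?L u \<noteq> 0" using SD[of u] r0(2) u b' by auto
    then show ?thesis using u g(3)[OF u(1)] by (simp add: f_def exp_minus divide_inverse)
  qed
  have g_deriv: "(g has_field_derivative - (?L (g s) / L' (g s))) (at s)" "L' (g s) \<noteq> 0" if s: "s \<in> U" for s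
  proof -
    obtain u where u: "u \<in> ball ?p r0" "s = f u" using s by (auto simp: U_def)
    have "u \<in> S" using u r0 by auto
    have eq: "deriv f u = - (L' u / ?L u)" by (rule DERIV_imp_deriv[OF f_deriv[OF \<open>u \<in> S\<close>]])
    have 1: "- (L' u / ?L u) * deriv g s = 1" using g(2)[OF u(1)] u(2) eq by simp
    then show nz: "L' (g s) \<noteq> 0" using u g(3)[OF u(1)] by auto
    have "deriv g s = - (?L u / L' u)"
    proof -
      have "L' u \<noteq> 0" using nz g(3)[OF u(1)] u by simp
      then have "deriv g s = - (?L u / L' u) * (- (L' u / ?L u) * deriv g s)"
        using SD(3)[OF \<open>u \<in> S\<close>] by simp
      then show ?thesis unfolding 1 by simp
    qed
    then show "(g has_field_derivative - (?L (g s) / L' (g s))) (at s)"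
      using holomorphic_derivI[OF g(1) U(1) s] u g(3)[OF u(1)] by simp
  qed
  define K where "K s = - Ln (g s / ?p)" for s
  have gp: "g s / ?p \<notin> \<real>\<^sub>\<le>\<^sub>0" if s: "s \<in> U" for s
  proof (rule pos)
    have "norm (?p - g s) < \<rho>"
      using gS[OF s] by (simp add: S_def B_def dist_norm)
    moreover have "1 - g s / ?p = (?p - g s) / ?p" using \<rho> by (simp add: diff_divide_distrib)
    ultimately show "g s / ?p \<in> ball 1 1" using \<rho> by (simp add: dist_norm norm_divide)
  qed
  \<comment> \<open>\<open>K' = - g' / g = L / (u L')\<close>; eliminating \<open>L'\<close> by the
    differential equation and \<open>L\<close> by \<open>b' L(u) = exp (- s)\<close> leaves only
    \<open>u\<close> and \<open>s\<close>.\<close>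
  have K_deriv: "(K has_field_derivative (1 / g s - of_real a) / (of_real b' * exp s + of_real b)) (at s)"
    if s: "s \<in> U" for s
  proof -
    let ?u = "g s"
    note u = SD[OF gS[OF s]]
    have nz: "1 - of_real a * ?u \<noteq> 0" using D_nonpos[OF u(1)] by auto
    have "(K has_field_derivative - (- (?L ?u / L' ?u) / ?u)) (at s)"
      unfolding K_def[abs_def]
      by (rule derivative_eq_intros g_deriv[OF s] gp[OF s] refl)+ (use u \<rho> in auto)
    moreover have "- (- (?L ?u / L' ?u) / ?u) = (1 / ?u - of_real a) / (of_real b' * exp s + of_real b)"
    proof -
      have e: "of_real b' * exp s + of_real b = (1 + of_real b * ?L ?u) / ?L ?u"
        using u(3) b' by (simp add: exp_g[OF s] field_simps)
      have "(1 / ?u - of_real a) = (1 - of_real a * ?u) / ?u"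
        using u(2) by (simp add: field_simps)
      then show ?thesis
        unfolding e L_ODE[OF u(1), symmetric] using u nz g_deriv(2)[OF s] by (simp add: field_simps)
    qed
    ultimately show ?thesis by simp
  qed
  \<comment> \<open>The closed ball is kept inside \<open>U\<close> so that the limit is bounded on
    the open ball, as needed for multiplying uniform limits.\<close>
  obtain \<delta> where \<delta>: "\<delta> > 0" "cball 0 \<delta> \<subseteq> U"
    using U open_contains_cball by blast
  have ballU: "ball 0 \<delta> \<subseteq> U" using \<delta>(2) ball_subset_cball by blast
  define F where "F n s = (\<Sum>k\<le>n. of_real (prob n k) * exp (of_nat k * s)) * exp (- of_nat n * K s)" for n s
  have F_eq: "q n (g s) = F n s * q n ?p" if s: "s \<in> U" for n s
  proof -
    have "g s / ?p \<noteq> 0" using gp[OF s] by auto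
    then have e: "exp (- of_nat n * K s) = (g s / ?p) ^ n"
      by (simp add: K_def exp_of_nat_mult)
    have t: "total n \<noteq> 0" using total_pos[of n] by simp
    have "F n s = (\<Sum>k\<le>n. of_real (gkp a b c 0 b' c' n k) * exp (of_nat k * s)) / of_real (total n) * (g s / ?p) ^ n"
      unfolding F_def e prob_def by (simp add: sum_divide_distrib)
    then show ?thesis
      unfolding q_eq[OF exp_g[OF s]] q_rho using \<rho> t by (simp add: power_divide)
  qed
  have limU: "uniform_limit U (\<lambda>n s. q n (g s)) (\<lambda>s. Q (g s)) sequentially"
    by (rule uniform_limit_compose'[OF lim]) (use gS in \<open>auto simp: S_def B_def\<close>)
  have K_holo: "K holomorphic_on U"
    using K_deriv by (auto simp: holomorphic_on_open U)
  have "continuous_on U (\<lambda>s. Q (g s))"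
  proof (rule uniform_limit_theorem[OF _ limU])
    have "continuous_on U (\<lambda>s. F n s * q n ?p)" for n
      unfolding F_def by (intro continuous_intros holomorphic_on_imp_continuous_on[OF K_holo])
    then show "\<forall>\<^sub>F n in sequentially. continuous_on U (\<lambda>s. q n (g s))"
      using F_eq by (simp cong: continuous_on_cong)
  qed simp
  then have "compact ((\<lambda>s. Q (g s)) ` cball 0 \<delta>)"
    using \<delta>(2) by (intro compact_continuous_image compact_cball) (rule continuous_on_subset)
  then have bdd: "bounded ((\<lambda>s. Q (g s)) ` ball 0 \<delta>)"
    by (meson ball_subset_cball bounded_subset compact_imp_bounded image_mono)
  have "(\<lambda>n. q n ?p) \<longlonglongrightarrow> Q ?p"
    using tendsto_uniform_limitI[OF lim] \<delta>1 by simp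
  then have "(\<lambda>n. inverse (q n ?p)) \<longlonglongrightarrow> inverse (Q ?p)"
    using Qp by (rule tendsto_inverse)
  then have lim_inv: "uniform_limit (ball 0 \<delta>) (\<lambda>n s::complex. inverse (q n ?p)) (\<lambda>s. inverse (Q ?p)) sequentially"
    by (auto simp: uniform_limit_iff tendsto_iff elim!: eventually_mono)
  have "uniform_limit (ball 0 \<delta>) (\<lambda>n s. q n (g s) * inverse (q n ?p)) (\<lambda>s. Q (g s) * inverse (Q ?p)) sequentially"
    by (rule uniform_lim_mult[OF uniform_limit_on_subset[OF limU ballU] lim_inv bdd])
       (rule finite_imp_bounded, rule finite_subset[of _ "{inverse (Q ?p)}"], auto)
  moreover have "q n (g s) * inverse (q n ?p) = F n s" if "s \<in> ball 0 \<delta>" for n s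
    using F_eq[of s n] that ballU q_rho_nonzero[of n] by auto
  ultimately have limF: "uniform_limit (ball 0 \<delta>) F (\<lambda>s. Q (g s) * inverse (Q ?p)) sequentially"
    by (subst (asm) uniform_limit_cong') auto
  have bb: "b' + b \<noteq> 0" using b b' by linarith
  have K1: "deriv K 0 = of_real m"
  proof -
    have "deriv K 0 = (1 / ?p - of_real a) / (of_real b' * exp 0 + of_real b)"
      using DERIV_imp_deriv[OF K_deriv[OF U(2)]] by (simp add: g0)
    also have "\<dots> = of_real ((1 / \<rho> - a) / (b' + b))"
      by simp
    also have "(1 / \<rho> - a) / (b' + b) = m"
      using \<rho> bb by (simp add: m_def divide_simps) 
    finally show ?thesis .
  qed
  have K2: "deriv (deriv K) 0 = of_real v"
  proof -
    have bb': "of_real b' * exp 0 + of_real b \<noteq> (0 :: complex)"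
      using bb by (simp flip: of_real_add)
    have gnz: "g 0 \<noteq> 0" using \<rho> by (simp add: g0)
    \<comment> \<open>\<open>g'(0) = - L(\<rho>) / L'(\<rho>)\<close>, with
      \<open>L'(\<rho>)\<close> taken from the differential equation.\<close>
    have g1: "(g has_field_derivative - of_real (m * \<rho>)) (at 0)"
    proof -
      have "of_real (1 - a * \<rho>) * L' ?p = of_real (1 + b / b')"
        using L_ODE[OF pD] by (simp add: L\<rho>)
      moreover have "1 - a * \<rho> \<noteq> 0" using \<rho> by simp
      ultimately have "L' ?p = of_real ((1 + b / b') / (1 - a * \<rho>))"
        by (metis nonzero_mult_div_cancel_left of_real_divide of_real_eq_0_iff)
      then have "?L ?p / L' ?p = of_real (1 / b' / ((1 + b / b') / (1 - a * \<rho>)))"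
        by (simp only: L\<rho> of_real_divide)
      also have "1 / b' / ((1 + b / b') / (1 - a * \<rho>)) = m * \<rho>"
        using b' bb \<rho> by (simp add: m_def divide_simps)
      finally show ?thesis using g_deriv(1)[OF U(2)] by (simp add: g0)
    qed
    have "((\<lambda>s. (1 / g s - of_real a) / (of_real b' * exp s + of_real b)) has_field_derivative
       ((of_real (m * \<rho>) / ?p ^ 2) * (of_real b' * exp 0 + of_real b) - (1 / ?p - of_real a) * of_real b')
         / (of_real b' * exp 0 + of_real b) ^ 2) (at 0)"
      by (rule derivative_eq_intros g1 gnz refl bb')+ (use \<rho> bb' in \<open>simp_all add: g0 power2_eq_square field_simps\<close>)
    also have "((of_real (m * \<rho>) / ?p ^ 2) * (of_real b' * exp 0 + of_real b) - (1 / ?p - of_real a) * of_real b')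
         / (of_real b' * exp 0 + of_real b) ^ 2 =
       of_real (((m * \<rho>) / \<rho> ^ 2 * (b' + b) - (1 / \<rho> - a) * b') / (b' + b) ^ 2)"
      by simp
    also have "((m * \<rho>) / \<rho> ^ 2 * (b' + b) - (1 / \<rho> - a) * b') / (b' + b) ^ 2 = v"
    proof -
      have "1 / \<rho> - a = m * (b' + b)" using \<rho> bb by (simp add: m_def divide_simps)
      then have "((m * \<rho>) / \<rho> ^ 2 * (b' + b) - (1 / \<rho> - a) * b') / (b' + b) ^ 2
        = ((m / \<rho>) * (b' + b) - m * (b' + b) * b') / (b' + b) ^ 2"
        using \<rho> by (simp add: power2_eq_square)
      also have "\<dots> = v"
        using \<rho> bb by (simp add: v_def power2_eq_square divide_simps) (simp add: algebra_simps)
      finally show ?thesis .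
    qed
    finally have "((\<lambda>s. (1 / g s - of_real a) / (of_real b' * exp s + of_real b)) has_field_derivative of_real v) (at 0)" .
    \<comment> \<open>The formula for \<open>K'\<close> holds on all of the open set
      \<open>U\<close>, so it may be differentiated.\<close>
    then have "(deriv K has_field_derivative of_real v) (at 0)"
      by (rule has_field_derivative_transform_within_open[OF _ U(1,2)])
         (use K_deriv DERIV_imp_deriv in metis)
    then show ?thesis by (rule DERIV_imp_deriv)
  qed
  show ?thesis
  proof (rule that[of K "\<lambda>s. Q (g s) * inverse (Q ?p)" \<delta>], unfold_locales)
    show "K holomorphic_on ball 0 \<delta>" using K_holo ballU by (rule holomorphic_on_subset)
    show "K 0 = 0" using \<rho> by (simp add: K_def g0)
  qed (use sum_prob \<delta> K1 K2 limF in \<open>simp_all add: F_def[abs_def]\<close>)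
qed

end

section \<open>From the array to the random variables\<close>

text \<open>The given probabilities add up to 1, so \<open>X\<close> takes its values in
  \<open>0..n\<close> almost surely. The Banach-valued form covers the moments and the complex
  characteristic function alike.\<close>

lemma finite_support_expectation:
  fixes f :: "int \<Rightarrow> 'b :: {banach, second_countable_topology}"
  assumes M: "prob_space M" and X: "X \<in> M \<rightarrow>\<^sub>M count_space UNIV"
    and p: "\<And>k. k \<le> n \<Longrightarrow> measure M {\<omega> \<in> space M. X \<omega> = int k} = p k"
    and sum: "(\<Sum>k\<le>n. p k) = (1 :: real)"
  shows "integral\<^sup>L M (\<lambda>\<omega>. f (X \<omega>)) = (\<Sum>k\<le>n. p k *\<^sub>R f (int k))"
proof -
  interpret prob_space M by fact
  define A where "A k = {\<omega> \<in> space M. X \<omega> = int k}" for k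
  have A: "A k \<in> sets M" for k
  proof -
    have "X -` {int k} \<inter> space M \<in> sets M" using X by (rule measurable_sets) simp
    also have "X -` {int k} \<inter> space M = A k" by (auto simp: A_def)
    finally show ?thesis .
  qed
  have "prob (\<Union>k\<le>n. A k) = (\<Sum>k\<le>n. prob (A k))"
    by (rule finite_measure_finite_Union) (use A in \<open>auto simp: disjoint_family_on_def A_def\<close>)
  also have "\<dots> = 1" using p sum by (simp add: A_def)
  finally have ae: "AE \<omega> in M. \<omega> \<in> (\<Union>k\<le>n. A k)"
    by (rule AE_prob_1)
  define g where "g \<omega> = (\<Sum>k\<le>n. indicat_real (A k) \<omega> *\<^sub>R f (int k))" for \<omega>
  have "integral\<^sup>L M (\<lambda>\<omega>. f (X \<omega>)) = integral\<^sup>L M g"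
  proof (rule integral_cong_AE)
    show "(\<lambda>\<omega>. f (X \<omega>)) \<in> borel_measurable M"
      using X by (rule measurable_compose) simp
    show "g \<in> borel_measurable M"
      unfolding g_def using A by measurable
    show "AE \<omega> in M. f (X \<omega>) = g \<omega>"
      using ae
    proof eventually_elim
      case (elim \<omega>)
      then obtain j where j: "j \<le> n" "\<omega> \<in> A j" by auto
      have "g \<omega> = (\<Sum>k\<le>n. if k = j then f (int k) else 0)"
        unfolding g_def using j by (intro sum.cong) (auto simp: A_def indicator_def)
      then show ?case using j by (simp add: A_def)
    qed
  qed
  also have "\<dots> = (\<Sum>k\<le>n. prob (A k) *\<^sub>R f (int k))"
    unfolding g_def using A
    by (subst Bochner_Integration.integral_sum) (auto simp: emeasure_eq_measure intro!: integrable_scaleR_left)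
  also have "\<dots> = (\<Sum>k\<le>n. p k *\<^sub>R f (int k))"
    using p by (simp add: A_def)
  finally show ?thesis .
qed

text \<open>Mean, variance and characteristic function of \<open>X n\<close> are finite sums over
  row \<open>n\<close>, so \<open>quasi_powers\<close> applies; Levy's continuity theorem turns
  \<open>char_tendsto\<close> into weak convergence.\<close>

theorem (in gkp_params) gkp_central_limit:
  fixes M :: "nat \<Rightarrow> 'w measure" and X :: "nat \<Rightarrow> 'w \<Rightarrow> int" and \<mu> \<sigma> :: "nat \<Rightarrow> real"
  assumes X: "\<And>n. gkp_random_variable a b c 0 b' c' n (M n) (X n)"
    and \<mu>: "\<And>n. \<mu> n = prob_space.expectation (M n) (\<lambda>\<omega>. real_of_int (X n \<omega>))"
    and \<sigma>: "\<And>n. \<sigma> n = sqrt (prob_space.variance (M n) (\<lambda>\<omega>. real_of_int (X n \<omega>)))"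
  shows "weak_conv_m (\<lambda>n. distr (M n) borel (\<lambda>\<omega>. (real_of_int (X n \<omega>) - \<mu> n) / \<sigma> n)) std_normal_distribution
     \<and> \<mu> \<sim>[at_top] (\<lambda>n. m * real n) \<and> (\<lambda>n. (\<sigma> n)\<^sup>2) \<sim>[at_top] (\<lambda>n. v * real n)"
proof -
  obtain K R \<delta> where "quasi_powers prob K R \<delta> m v"
    by (rule obtain_quasi_powers)
  then interpret quasi_powers prob K R \<delta> m v .
  have M: "prob_space (M n)" and meas: "X n \<in> M n \<rightarrow>\<^sub>M count_space UNIV"
    and P: "k \<le> n \<Longrightarrow> measure (M n) {\<omega> \<in> space (M n). X n \<omega> = int k} = prob n k" for n k
    using X[of n] by (auto simp: gkp_random_variable_def prob_def total_def)
  note expectation = finite_support_expectation[OF M meas P sum_prob]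
  have \<mu>_eq: "\<mu> n = mean n" for n
    unfolding \<mu> using expectation[of n "\<lambda>x. real_of_int x"] by (simp add: mean_def)
  have \<sigma>_eq: "\<sigma> n = sqrt (var n)" for n
    unfolding \<sigma> \<mu>[symmetric]
    using expectation[of n "\<lambda>x. (real_of_int x - \<mu> n)\<^sup>2"] by (simp add: var_def \<mu>_eq)
  have "prob n k \<ge> 0" for n k
    using total_pos[of n] gkp_nonneg[of a b c b' c' n k] a b c b' c' by (simp add: prob_def)
  then have "var n \<ge> 0" for n
    unfolding var_def by (intro sum_nonneg mult_nonneg_nonneg) auto
  then have \<sigma>2: "(\<lambda>n. (\<sigma> n)\<^sup>2) = var"
    by (simp add: \<sigma>_eq)
  have rv: "(\<lambda>\<omega>. (real_of_int (X n \<omega>) - \<mu> n) / \<sigma> n) \<in> borel_measurable (M n)" for n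
    using meas[of n] by (rule measurable_compose) simp
  have "weak_conv_m (\<lambda>n. distr (M n) borel (\<lambda>\<omega>. (real_of_int (X n \<omega>) - \<mu> n) / \<sigma> n)) std_normal_distribution"
  proof (rule levy_continuity)
    show "real_distribution (distr (M n) borel (\<lambda>\<omega>. (real_of_int (X n \<omega>) - \<mu> n) / \<sigma> n))" for n
      using prob_space.real_distribution_distr[OF M rv] .
    show "real_distribution std_normal_distribution"
      by (rule real_dist_normal_dist)
    fix t
    have "char (distr (M n) borel (\<lambda>\<omega>. (real_of_int (X n \<omega>) - \<mu> n) / \<sigma> n)) t =
       (\<Sum>k\<le>n. of_real (prob n k) * exp (\<i> * of_real (t * ((real k - mean n) / sqrt (var n)))))" for n
    proof -
      have "char (distr (M n) borel (\<lambda>\<omega>. (real_of_int (X n \<omega>) - \<mu> n) / \<sigma> n)) t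
         = (CLINT \<omega>|M n. iexp (t * ((real_of_int (X n \<omega>) - \<mu> n) / \<sigma> n)))"
        unfolding char_def by (rule integral_distr[OF rv]) simp
      also have "\<dots> = (\<Sum>k\<le>n. prob n k *\<^sub>R iexp (t * ((real_of_int (int k) - \<mu> n) / \<sigma> n)))"
        by (rule expectation[of n "\<lambda>x. iexp (t * ((real_of_int x - \<mu> n) / \<sigma> n))"])
      finally show ?thesis
        unfolding \<mu>_eq \<sigma>_eq scaleR_conv_of_real of_int_of_nat_eq .
    qed
    then show "(\<lambda>n. char (distr (M n) borel (\<lambda>\<omega>. (real_of_int (X n \<omega>) - \<mu> n) / \<sigma> n)) t)
        \<longlonglongrightarrow> char std_normal_distribution t"
      unfolding char_std_normal_distribution using char_tendsto[OF v_pos, of t] by (simp only:)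
  qed
  moreover have "\<mu> \<sim>[at_top] (\<lambda>n. m * real n)"
    using mean_asymp m_pos by (simp add: \<mu>_eq[abs_def])
  moreover have "(\<lambda>n. (\<sigma> n)\<^sup>2) \<sim>[at_top] (\<lambda>n. v * real n)"
    using var_asymp v_pos unfolding \<sigma>2 by simp
  ultimately show ?thesis by blast
qed

text \<open>In each regime the closed form of \<open>L\<close> is solved for \<open>\<rho>\<close>,
  and the constants \<open>m\<close> and \<open>v\<close> of \<open>gkp_params\<close> are
  identified with the negatives of the stated ones.\<close>

theorem theorem2:
  fixes \<alpha> \<beta> \<gamma> \<alpha>' \<beta>' \<gamma>' :: real
    and M :: "nat \<Rightarrow> 'w measure" and X :: "nat \<Rightarrow> 'w \<Rightarrow> int"
    and \<mu> \<sigma> :: "nat \<Rightarrow> real"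
  assumes "\<alpha>' = 0" and "\<alpha> \<ge> 0" and "\<beta> \<ge> 0" and "\<gamma> \<ge> 0" and "\<gamma>' \<ge> 0" and "\<beta>' > 0"
    and "\<And>n. gkp_random_variable \<alpha> \<beta> \<gamma> \<alpha>' \<beta>' \<gamma>' n (M n) (X n)"
    and "\<And>n. \<mu> n = prob_space.expectation (M n) (\<lambda>\<omega>. real_of_int (X n \<omega>))"
    and "\<And>n. \<sigma> n = sqrt (prob_space.variance (M n) (\<lambda>\<omega>. real_of_int (X n \<omega>)))"
  shows
    "(\<alpha> > 0 \<and> \<beta> > 0 \<longrightarrow>
       (let \<rho>1 = 1 / \<alpha> * (1 - (1 + \<beta> / \<beta>') powr (- \<alpha> / \<beta>));
            \<mm> = - (\<alpha> * (1 + \<beta> / \<beta>') powr (- 1 - \<alpha> / \<beta>)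
                   / (\<beta>' * (1 - (1 + \<beta> / \<beta>') powr (- \<alpha> / \<beta>))));
            \<vv> = (1 + \<beta> / \<beta>') powr (- 2 - \<alpha> / \<beta>) / (\<rho>1 * \<beta>')\<^sup>2
                 * (\<beta>' / \<alpha> * (1 - (1 + \<beta> / \<beta>') powr (- \<alpha> / \<beta>)) - 1)
        in weak_conv_m (\<lambda>n. distr (M n) borel (\<lambda>\<omega>. (real_of_int (X n \<omega>) - \<mu> n) / \<sigma> n))
             std_normal_distribution
           \<and> \<mu> \<sim>[at_top] (\<lambda>n. - \<mm> * real n)
           \<and> (\<lambda>n. (\<sigma> n)\<^sup>2) \<sim>[at_top] (\<lambda>n. - \<vv> * real n)))
     \<and> (\<alpha> = 0 \<and> \<beta> > 0 \<longrightarrow>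
       (let \<rho>1 = 1 / \<beta> * ln (1 + \<beta> / \<beta>');
            \<mm> = - \<beta> / ((\<beta>' + \<beta>) * ln (1 + \<beta> / \<beta>'));
            \<vv> = (\<beta>' / \<beta> * ln (1 + \<beta> / \<beta>') - 1) / (\<rho>1 * (\<beta>' + \<beta>))\<^sup>2
        in weak_conv_m (\<lambda>n. distr (M n) borel (\<lambda>\<omega>. (real_of_int (X n \<omega>) - \<mu> n) / \<sigma> n))
             std_normal_distribution
           \<and> \<mu> \<sim>[at_top] (\<lambda>n. - \<mm> * real n)
           \<and> (\<lambda>n. (\<sigma> n)\<^sup>2) \<sim>[at_top] (\<lambda>n. - \<vv> * real n)))
     \<and> (\<alpha> > 0 \<and> \<beta> = 0 \<longrightarrow>
       (let \<rho>1 = 1 / \<alpha> * (1 - exp (- \<alpha> / \<beta>'));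
            \<mm> = \<alpha> * exp (- \<alpha> / \<beta>') / (\<beta>' * (exp (- \<alpha> / \<beta>') - 1));
            \<vv> = exp (- \<alpha> / \<beta>') / (\<rho>1 * \<beta>')\<^sup>2 * (\<beta>' / \<alpha> * (1 - exp (- \<alpha> / \<beta>')) - 1)
        in weak_conv_m (\<lambda>n. distr (M n) borel (\<lambda>\<omega>. (real_of_int (X n \<omega>) - \<mu> n) / \<sigma> n))
             std_normal_distribution
           \<and> \<mu> \<sim>[at_top] (\<lambda>n. - \<mm> * real n)
           \<and> (\<lambda>n. (\<sigma> n)\<^sup>2) \<sim>[at_top] (\<lambda>n. - \<vv> * real n)))"
proof (intro conjI impI)
  have r1: "1 + \<beta> / \<beta>' > 1" if "\<beta> > 0" using that assms(6) by simp
  note rv = assms(7)[unfolded assms(1)]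
  {
    assume *: "\<alpha> > 0 \<and> \<beta> > 0"
    define B where "B = 1 + \<beta> / \<beta>'"
    \<comment> \<open>\<open>e\<close> will be \<open>1 - \<alpha> * \<rho>\<close>, the value for
      which \<open>(1 - \<alpha> \<rho>) powr (- \<beta> / \<alpha>) = B\<close>.\<close>
    define e where "e = B powr (- \<alpha> / \<beta>)"
    define \<rho> where "\<rho> = 1 / \<alpha> * (1 - e)"
    have B: "B > 1" "\<beta>' * B = \<beta>' + \<beta>" using * assms(6) by (auto simp: B_def field_simps)
    have e: "0 < e" "e < 1" using B * by (auto simp: e_def powr_less_one)
    have a\<rho>: "\<alpha> * \<rho> = 1 - e" using * by (simp add: \<rho>_def)
    have eB: "B powr (- 1 - \<alpha> / \<beta>) = e / B" "B powr (- 2 - \<alpha> / \<beta>) = e / B\<^sup>2"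
    proof -
      have "B powr (- 1 - \<alpha> / \<beta>) = B powr (- \<alpha> / \<beta> - 1)" "B powr (- 2 - \<alpha> / \<beta>) = B powr (- \<alpha> / \<beta> - 2)"
        by (rule arg_cong[of _ _ "(powr) B"], simp)+
      then show "B powr (- 1 - \<alpha> / \<beta>) = e / B" "B powr (- 2 - \<alpha> / \<beta>) = e / B\<^sup>2"
        using B by (simp_all add: e_def powr_diff)
    qed
    have \<rho>_pos: "\<rho> > 0" using e * by (simp add: \<rho>_def)
    interpret L_params \<alpha> \<beta> using * by unfold_locales auto
    interpret gkp_params \<alpha> \<beta> \<gamma> \<beta>' \<gamma>' \<rho>
    proof
      \<comment> \<open>Hence \<open>L \<rho> = (B - 1) / \<beta> = 1 / \<beta>'\<close>.\<close>
      have "(1 - \<alpha> * \<rho>) powr (- \<beta> / \<alpha>) = B"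
        using * B by (simp add: a\<rho> e_def powr_powr)
      then show "L_fun \<alpha> \<beta> (of_real \<rho>) = of_real (1 / \<beta>')"
        using L_eval_powr[of \<rho>] * e a\<rho> \<rho>_pos assms(6) by (simp add: B_def)
    qed (use assms * e a\<rho> \<rho>_pos in auto)
    have m: "m = - (- (\<alpha> * (e / B) / (\<beta>' * (1 - e))))"
    proof -
      have "m = e / (\<rho> * (\<beta>' * B))" by (simp add: m_def B(2) a\<rho>)
      \<comment> \<open>Expanding the fraction by \<open>\<alpha>\<close> replaces
        \<open>\<rho>\<close> by \<open>\<alpha> * \<rho> = 1 - e\<close>.\<close>
      also have "\<dots> = \<alpha> * (e / B) / (\<beta>' * (\<alpha> * \<rho>))" using * by (simp add: mult_ac)
      finally show ?thesis unfolding a\<rho> by simp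
    qed
    have v: "v = - (e / B\<^sup>2 / (\<rho> * \<beta>')\<^sup>2 * (\<beta>' / \<alpha> * (1 - e) - 1))"
    proof -
      have "\<beta>' / \<alpha> * (1 - e) = \<beta>' * \<rho>" by (simp add: \<rho>_def)
      moreover have "1 - \<alpha> * \<rho> = e" using a\<rho> by simp
      ultimately have "v = e / (\<rho> * (\<beta>' * B)) * (1 - \<beta>' * \<rho>) / (\<rho> * (\<beta>' * B))"
        by (simp add: v_def m_def B(2))
      also have "\<dots> = - (e / B\<^sup>2 / (\<rho> * \<beta>')\<^sup>2 * (\<beta>' * \<rho> - 1))"
        using \<rho>_pos B(1) assms(6) by (simp add: power2_eq_square divide_simps) (simp add: algebra_simps)
      finally show ?thesis by (simp add: \<rho>_def)
    qed
    show "let \<rho>1 = 1 / \<alpha> * (1 - (1 + \<beta> / \<beta>') powr (- \<alpha> / \<beta>));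
            \<mm> = - (\<alpha> * (1 + \<beta> / \<beta>') powr (- 1 - \<alpha> / \<beta>)
                   / (\<beta>' * (1 - (1 + \<beta> / \<beta>') powr (- \<alpha> / \<beta>))));
            \<vv> = (1 + \<beta> / \<beta>') powr (- 2 - \<alpha> / \<beta>) / (\<rho>1 * \<beta>')\<^sup>2
                 * (\<beta>' / \<alpha> * (1 - (1 + \<beta> / \<beta>') powr (- \<alpha> / \<beta>)) - 1)
        in weak_conv_m (\<lambda>n. distr (M n) borel (\<lambda>\<omega>. (real_of_int (X n \<omega>) - \<mu> n) / \<sigma> n))
             std_normal_distribution
           \<and> \<mu> \<sim>[at_top] (\<lambda>n. - \<mm> * real n)
           \<and> (\<lambda>n. (\<sigma> n)\<^sup>2) \<sim>[at_top] (\<lambda>n. - \<vv> * real n)"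
      using gkp_central_limit[OF rv assms(8,9)]
      unfolding Let_def B_def[symmetric] eB e_def[symmetric] \<rho>_def[symmetric] m v .
  next
    assume *: "\<alpha> = 0 \<and> \<beta> > 0"
    define l where "l = ln (1 + \<beta> / \<beta>')"
    define \<rho> where "\<rho> = 1 / \<beta> * l"
    have l: "l > 0" using r1 * by (simp add: l_def)
    have \<rho>_pos: "\<rho> > 0" using l * by (simp add: \<rho>_def)
    interpret L_params \<alpha> \<beta> using * by unfold_locales auto
    interpret gkp_params \<alpha> \<beta> \<gamma> \<beta>' \<gamma>' \<rho>
    proof
      \<comment> \<open>This gives \<open>L \<rho> = (exp (\<beta> \<rho>) - 1) / \<beta> = 1 /
        \<beta>'\<close>.\<close>
      have "exp (\<beta> * \<rho>) = 1 + \<beta> / \<beta>'"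
        using * r1 by (simp add: \<rho>_def l_def)
      then show "L_fun \<alpha> \<beta> (of_real \<rho>) = of_real (1 / \<beta>')"
        using L_eval_exp[of \<rho>] * by simp
    qed (use assms * \<rho>_pos in auto)
    have m: "m = - (- \<beta> / ((\<beta>' + \<beta>) * l))"
      unfolding m_def using * l by (simp add: \<rho>_def mult.commute)
    have v: "v = - ((\<beta>' / \<beta> * l - 1) / (\<rho> * (\<beta>' + \<beta>))\<^sup>2)"
    proof -
      have "\<beta>' / \<beta> * l = \<beta>' * \<rho>" by (simp add: \<rho>_def)
      then show ?thesis
        unfolding v_def m_def using * by (simp add: power2_eq_square diff_divide_distrib)
    qed
    show "let \<rho>1 = 1 / \<beta> * ln (1 + \<beta> / \<beta>');
            \<mm> = - \<beta> / ((\<beta>' + \<beta>) * ln (1 + \<beta> / \<beta>'));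
            \<vv> = (\<beta>' / \<beta> * ln (1 + \<beta> / \<beta>') - 1) / (\<rho>1 * (\<beta>' + \<beta>))\<^sup>2
        in weak_conv_m (\<lambda>n. distr (M n) borel (\<lambda>\<omega>. (real_of_int (X n \<omega>) - \<mu> n) / \<sigma> n))
             std_normal_distribution
           \<and> \<mu> \<sim>[at_top] (\<lambda>n. - \<mm> * real n)
           \<and> (\<lambda>n. (\<sigma> n)\<^sup>2) \<sim>[at_top] (\<lambda>n. - \<vv> * real n)"
      using gkp_central_limit[OF rv assms(8,9)]
      unfolding Let_def l_def[symmetric] \<rho>_def[symmetric] m v .
  next
    assume *: "\<alpha> > 0 \<and> \<beta> = 0"
    define e where "e = exp (- \<alpha> / \<beta>')"
    define \<rho> where "\<rho> = 1 / \<alpha> * (1 - e)"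
    have e: "0 < e" "e < 1" using * assms(6) by (auto simp: e_def)
    have a\<rho>: "\<alpha> * \<rho> = 1 - e" using * by (simp add: \<rho>_def)
    have \<rho>_pos: "\<rho> > 0" using e * by (simp add: \<rho>_def)
    interpret L_params \<alpha> \<beta> using * by unfold_locales auto
    interpret gkp_params \<alpha> \<beta> \<gamma> \<beta>' \<gamma>' \<rho>
    proof
      \<comment> \<open>This gives \<open>L \<rho> = - ln (1 - \<alpha> \<rho>) / \<alpha> = 1 /
        \<beta>'\<close>.\<close>
      have "ln (1 - \<alpha> * \<rho>) = - \<alpha> / \<beta>'"
        by (simp add: a\<rho> e_def)
      then show "L_fun \<alpha> \<beta> (of_real \<rho>) = of_real (1 / \<beta>')"
        using L_eval_ln[of \<rho>] * e a\<rho> \<rho>_pos by simp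
    qed (use assms * e a\<rho> \<rho>_pos in auto)
    have m: "m = - (\<alpha> * e / (\<beta>' * (e - 1)))"
    proof -
      have "m = e / (\<rho> * \<beta>')" unfolding m_def using * a\<rho> by simp
      also have "\<dots> = \<alpha> * e / (\<beta>' * (\<alpha> * \<rho>))" using * \<rho>_pos by simp
      also have "\<dots> = - (\<alpha> * e / (\<beta>' * (e - 1)))"
        unfolding a\<rho> minus_divide_right by (simp add: algebra_simps)
      finally show ?thesis .
    qed
    have v: "v = - (e / (\<rho> * \<beta>')\<^sup>2 * (\<beta>' / \<alpha> * (1 - e) - 1))"
    proof -
      have "\<beta>' / \<alpha> * (1 - e) = \<beta>' * \<rho>" by (simp add: \<rho>_def)
      moreover have "1 - \<alpha> * \<rho> = e" using a\<rho> by simp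
      ultimately have "v = e / (\<rho> * \<beta>') * (1 - \<beta>' * \<rho>) / (\<rho> * \<beta>')"
        unfolding v_def m_def using * by simp
      also have "\<dots> = - (e / (\<rho> * \<beta>')\<^sup>2 * (\<beta>' * \<rho> - 1))"
        using \<rho>_pos assms(6) by (simp add: power2_eq_square divide_simps) (simp add: algebra_simps)
      finally show ?thesis by (simp add: \<rho>_def)
    qed
    show "let \<rho>1 = 1 / \<alpha> * (1 - exp (- \<alpha> / \<beta>'));
            \<mm> = \<alpha> * exp (- \<alpha> / \<beta>') / (\<beta>' * (exp (- \<alpha> / \<beta>') - 1));
            \<vv> = exp (- \<alpha> / \<beta>') / (\<rho>1 * \<beta>')\<^sup>2 * (\<beta>' / \<alpha> * (1 - exp (- \<alpha> / \<beta>')) - 1)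
        in weak_conv_m (\<lambda>n. distr (M n) borel (\<lambda>\<omega>. (real_of_int (X n \<omega>) - \<mu> n) / \<sigma> n))
             std_normal_distribution
           \<and> \<mu> \<sim>[at_top] (\<lambda>n. - \<mm> * real n)
           \<and> (\<lambda>n. (\<sigma> n)\<^sup>2) \<sim>[at_top] (\<lambda>n. - \<vv> * real n)"
      using gkp_central_limit[OF rv assms(8,9)]
      unfolding Let_def e_def[symmetric] \<rho>_def[symmetric] m v .
  }
qed

end
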